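(* Assume: (A1) $[0,T]$, $X$, $X_u$, $X_0$ are all compact, $X_0\subset X\subset\mathbb{R}^n$, and $n$ is finite; (A2) $f(t,x)$ is Lipschitz in each argument on $[0,T]\times X$; (A3) $c$ is continuous on $X\times X_u$; (A4) if $x(t\mid x_0)\in\partial X$ for some $t\in[0,T]$, $x_0\in X_0$, then $x(t'\mid x_0)\notin X$ for all $t'\in(t,T]$. Let $P^*$ be the distance of closest approach of trajectories to $X_u$ (defined in the context), and let $$\begin{aligned} d^*=\sup_{\gamma\in\mathbb{R},\,v,\,w}\ & \gamma\\ \text{s.t. } & v(0,x)\ge\gamma && \forall x\in X_0,\\ & c(x,y)\ge w(x) && \forall (x,y)\in X\times X_u,\\ & w(x)\ge v(t,x) && \forall (t,x)\in[0,T]\times X,\\ & \mathcal{L}_f v(t,x)\ge 0 && \forall (t,x)\in[0,T]\times X,\\ & w\in C(X),\ v\in C^1([0,T]\times X).\end{aligned}$$ Then $d^*=P^*$.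
   Context: $X_0\subset X$ (initial set), $X_u\subset X$ (unsafe set), both nonempty; $f:[0,T]\times\mathbb{R}^n\to\mathbb{R}^n$ is locally Lipschitz, and $x(t\mid x_0)$ is the trajectory of $\dot x(t)=f(t,x(t))$ with $x(0)=x_0$ (on its interval of existence). The state is restricted to $X$: a pair $(t,x_0)\in[0,T]\times X_0$ is admissible if $x(s\mid x_0)$ exists and lies in $X$ for all $s\in[0,t]$. The distance of closest approach is $$P^*=\inf\{\,c(x(t\mid x_0),y): (t,x_0)\in[0,T]\times X_0\text{ admissible},\ y\in X_u\,\}.$$ $C^1([0,T]\times X)$ denotes functions continuously differentiable on a neighbourhood of $[0,T]\times X$, and $\mathcal{L}_f v(t,x)=\partial_t v(t,x)+f(t,x)\cdot\nabla_x v(t,x)$. *)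

theory Defs
  imports "HOL-Analysis.Analysis"
begin

text \<open>
  \<open>local_lipschitz\<close> of the library is local Lipschitz continuity in the state only; here a vector
  field is locally Lipschitz jointly in time and state.
\<close>

definition locally_lipschitz_on ::
    "'a::metric_space set \<Rightarrow> ('a \<Rightarrow> 'b::metric_space) \<Rightarrow> bool" where
  "locally_lipschitz_on S g \<longleftrightarrow>
     (\<forall>p\<in>S. \<exists>u>0. \<exists>L. L-lipschitz_on (cball p u \<inter> S) g)"

definition solution_upto ::
    "(real \<Rightarrow> real^'n \<Rightarrow> real^'n) \<Rightarrow> real^'n \<Rightarrow> real \<Rightarrow> (real \<Rightarrow> real^'n) \<Rightarrow> bool" where
  "solution_upto f x0 t \<phi> \<longleftrightarrow>
     \<phi> 0 = x0 \<and> (\<forall>s\<in>{0..t}. (\<phi> has_vector_derivative f s (\<phi> s)) (at s within {0..t}))"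

definition traj_exists :: "(real \<Rightarrow> real^'n \<Rightarrow> real^'n) \<Rightarrow> real^'n \<Rightarrow> real \<Rightarrow> bool" where
  "traj_exists f x0 t \<longleftrightarrow> (\<exists>\<phi>. solution_upto f x0 t \<phi>)"

text \<open>
  The point \<open>x(t | x0)\<close>. For a locally Lipschitz \<open>f\<close> all solutions on \<open>[0,t]\<close> starting in \<open>x0\<close>
  agree there, so the description is proper whenever \<open>traj_exists f x0 t\<close> holds; otherwise the
  value is arbitrary, and every use below is guarded by \<open>traj_exists\<close>.
\<close>

definition traj :: "(real \<Rightarrow> real^'n \<Rightarrow> real^'n) \<Rightarrow> real^'n \<Rightarrow> real \<Rightarrow> real^'n" where
  "traj f x0 t = (THE z. \<exists>\<phi>. solution_upto f x0 t \<phi> \<and> \<phi> t = z)"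

definition traj_in ::
    "(real \<Rightarrow> real^'n \<Rightarrow> real^'n) \<Rightarrow> real^'n \<Rightarrow> real \<Rightarrow> (real^'n) set \<Rightarrow> bool" where
  "traj_in f x0 t A \<longleftrightarrow> traj_exists f x0 t \<and> traj f x0 t \<in> A"

definition admissible ::
    "real \<Rightarrow> (real^'n) set \<Rightarrow> (real^'n) set \<Rightarrow> (real \<Rightarrow> real^'n \<Rightarrow> real^'n) \<Rightarrow> (real \<times> (real^'n)) set" where
  "admissible T X X0 f = {(t, x0). t \<in> {0..T} \<and> x0 \<in> X0 \<and> (\<forall>s\<in>{0..t}. traj_in f x0 s X)}"

text \<open>
  Both optimal values are extended reals, so that infimum and supremum have their usual meaning
  without side conditions on nonemptiness and boundedness.
\<close>

definition closest_approach ::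
    "real \<Rightarrow> (real^'n) set \<Rightarrow> (real^'n) set \<Rightarrow> (real^'n) set
     \<Rightarrow> (real \<Rightarrow> real^'n \<Rightarrow> real^'n) \<Rightarrow> (real^'n \<Rightarrow> real^'n \<Rightarrow> real) \<Rightarrow> ereal" where
  "closest_approach T X X0 Xu f c =
     Inf {ereal (c (traj f x0 t) y) | t x0 y. (t, x0) \<in> admissible T X X0 f \<and> y \<in> Xu}"

definition C1_near :: "'a::real_normed_vector set \<Rightarrow> ('a \<Rightarrow> real) \<Rightarrow> bool" where
  "C1_near S v \<longleftrightarrow>
     (\<exists>U (v' :: 'a \<Rightarrow> ('a \<Rightarrow>\<^sub>L real)). open U \<and> S \<subseteq> U
        \<and> (\<forall>p\<in>U. (v has_derivative blinfun_apply (v' p)) (at p)) \<and> continuous_on U v')"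

definition gradient :: "('a::real_inner \<Rightarrow> real) \<Rightarrow> 'a \<Rightarrow> 'a" where
  "gradient g x = (THE D. GDERIV g x :> D)"

definition lie_derivative ::
    "(real \<Rightarrow> real^'n \<Rightarrow> real^'n) \<Rightarrow> (real \<times> (real^'n) \<Rightarrow> real) \<Rightarrow> real \<times> (real^'n) \<Rightarrow> real" where
  "lie_derivative f v = (\<lambda>(t, x).
     deriv (\<lambda>s. v (s, x)) t + f t x \<bullet> gradient (\<lambda>z. v (t, z)) x)"

definition dual_feasible ::
    "real \<Rightarrow> (real^'n) set \<Rightarrow> (real^'n) set \<Rightarrow> (real^'n) set
     \<Rightarrow> (real \<Rightarrow> real^'n \<Rightarrow> real^'n) \<Rightarrow> (real^'n \<Rightarrow> real^'n \<Rightarrow> real)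
     \<Rightarrow> real \<Rightarrow> (real \<times> (real^'n) \<Rightarrow> real) \<Rightarrow> (real^'n \<Rightarrow> real) \<Rightarrow> bool" where
  "dual_feasible T X X0 Xu f c \<gamma> v w \<longleftrightarrow>
     (\<forall>x\<in>X0. v (0, x) \<ge> \<gamma>)
   \<and> (\<forall>x\<in>X. \<forall>y\<in>Xu. c x y \<ge> w x)
   \<and> (\<forall>t\<in>{0..T}. \<forall>x\<in>X. w x \<ge> v (t, x))
   \<and> (\<forall>t\<in>{0..T}. \<forall>x\<in>X. lie_derivative f v (t, x) \<ge> 0)
   \<and> continuous_on X w
   \<and> C1_near ({0..T} \<times> X) v"

definition dual_value ::
    "real \<Rightarrow> (real^'n) set \<Rightarrow> (real^'n) set \<Rightarrow> (real^'n) set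
     \<Rightarrow> (real \<Rightarrow> real^'n \<Rightarrow> real^'n) \<Rightarrow> (real^'n \<Rightarrow> real^'n \<Rightarrow> real) \<Rightarrow> ereal" where
  "dual_value T X X0 Xu f c = Sup {ereal \<gamma> | \<gamma> v w. dual_feasible T X X0 Xu f c \<gamma> v w}"

end

theory Submission
  imports Defs
begin

text \<open>
  Weak duality holds because \<open>v\<close> does not decrease along an admissible trajectory. For the converse,
  near-optimal \<open>v\<close> are constructed directly from a penalised value function. Cut \<open>f\<close> off to a
  bounded Lipschitz field, let \<open>\<Phi>\<close> be the flow of the augmented field \<open>(1, f)\<close>, put \<open>Q = [0,T] \<times> X\<close>,
  and let \<open>W\<^sub>k\<close> be a Lipschitz minorant of \<open>x \<mapsto> min\<^sub>y c(x,y)\<close>. Instead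
  of forcing trajectories to stay in \<open>Q\<close>, charge them for the time spent outside:
  \<open>V\<^sub>k(p) = inf\<^sub>s (W\<^sub>k(\<Phi>\<^sub>s p) + k \<integral>\<^sub>0\<^sup>s dist(\<Phi>\<^sub>r p, Q) dr)\<close>.
  This is Lipschitz and, up to the penalty, nondecreasing along the flow, so that a mollification has
  Lie derivative almost \<open>\<ge> 0\<close> on \<open>Q\<close>; a small multiple of \<open>t\<close> repairs the sign. By compactness
  \<open>V\<^sub>k(0,\<cdot>) \<ge> P\<^sup>* - \<epsilon>\<close> on \<open>X\<^sub>0\<close> for some \<open>k\<close>: limits of cheap trajectories as \<open>k \<rightarrow> \<infinity>\<close> stay in \<open>Q\<close>
  and are admissible.
\<close>

subsection \<open>Flows of bounded Lipschitz fields\<close>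

text \<open>The field is autonomous and the initial value is left free, so that a time shift of a
  solution is again a solution. Time dependence is recovered below through an extra
  coordinate.\<close>

definition solves_upto :: "('a::real_normed_vector \<Rightarrow> 'a) \<Rightarrow> real \<Rightarrow> (real \<Rightarrow> 'a) \<Rightarrow> bool" where
  "solves_upto F t \<phi> \<longleftrightarrow> (\<forall>s\<in>{0..t}. (\<phi> has_vector_derivative F (\<phi> s)) (at s within {0..t}))"

lemma solves_upto_continuous:
  assumes "solves_upto F t \<phi>"
  shows "continuous_on {0..t} \<phi>"
  using assms unfolding solves_upto_def
  by (intro continuous_on_vector_derivative) auto

lemma solves_upto_at:
  assumes "solves_upto F t \<phi>" "0 < s" "s < t"
  shows "(\<phi> has_vector_derivative F (\<phi> s)) (at s)"
  using assms at_within_Icc_at[of 0 s t] unfolding solves_upto_def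
  by (metis atLeastAtMost_iff less_eq_real_def)

lemma solves_upto_shift:
  assumes "solves_upto F (h + t) \<phi>" "0 \<le> h"
  shows "solves_upto F t (\<lambda>s. \<phi> (s + h))"
  unfolding solves_upto_def
proof
  fix s assume s: "s \<in> {0..t}"
  have 1: "(\<phi> has_vector_derivative F (\<phi> (s + h))) (at (s + h) within {0..h + t})"
    using assms s unfolding solves_upto_def by auto
  have 2: "((\<lambda>s. s + h) has_vector_derivative 1) (at s within {0..t})"
    by (auto intro!: derivative_eq_intros)
  have "(\<phi> has_vector_derivative F (\<phi> (s + h))) (at (s + h) within (\<lambda>s. s + h) ` {0..t})"
    by (rule has_vector_derivative_within_subset[OF 1]) (use assms in auto)
  from vector_diff_chain_within[OF 2 this]
  show "((\<lambda>s. \<phi> (s + h)) has_vector_derivative F (\<phi> (s + h))) (at s within {0..t})"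
    by (simp add: o_def)
qed

text \<open>The squared distance, damped by \<open>exp (- 2 * L * s)\<close>, is nonincreasing;
  working with the inner product keeps it differentiable where the curves meet. The Lipschitz bound
  is taken on a set containing both curves, to serve globally Lipschitz fields as well as fields
  controlled only on compact sets.\<close>

lemma gronwall_solutions:
  fixes F :: "'a::real_inner \<Rightarrow> 'a"
  assumes L: "L-lipschitz_on B F"
    and sol: "solves_upto F t \<phi>" "solves_upto F t \<psi>"
    and B: "\<And>s. s \<in> {0..t} \<Longrightarrow> \<phi> s \<in> B" "\<And>s. s \<in> {0..t} \<Longrightarrow> \<psi> s \<in> B"
    and "0 \<le> t"
  shows "dist (\<phi> t) (\<psi> t) \<le> exp (L * t) * dist (\<phi> 0) (\<psi> 0)"
proof -
  define d where "d = (\<lambda>s. \<phi> s - \<psi> s)"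
  define u where "u = (\<lambda>s. exp (- 2 * L * s) * (d s \<bullet> d s))"
  have "u t \<le> u 0"
  proof (rule DERIV_nonpos_imp_decreasing_open[OF \<open>0 \<le> t\<close>])
    fix s assume s: "0 < s" "s < t"
    let ?D = "F (\<phi> s) - F (\<psi> s)"
    have d: "(d has_vector_derivative ?D) (at s)"
      unfolding d_def using s solves_upto_at[OF sol(1)] solves_upto_at[OF sol(2)]
      by (intro has_vector_derivative_diff) auto
    have dd: "((\<lambda>s. d s \<bullet> d s) has_real_derivative 2 * (d s \<bullet> ?D)) (at s)"
      using has_derivative_inner[OF d[unfolded has_vector_derivative_def] d[unfolded has_vector_derivative_def]]
      unfolding has_field_derivative_def
      by (auto elim!: has_derivative_eq_rhs simp: fun_eq_iff inner_commute algebra_simps)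
    have u: "(u has_real_derivative
        exp (- 2 * L * s) * (2 * (d s \<bullet> ?D) - 2 * L * (d s \<bullet> d s))) (at s)"
      unfolding u_def by (rule derivative_eq_intros dd refl | simp add: algebra_simps)+
    have "d s \<bullet> ?D \<le> norm (d s) * norm ?D"
      by (rule norm_cauchy_schwarz)
    also have "\<dots> \<le> norm (d s) * (L * norm (d s))"
      using lipschitz_onD[OF L, of "\<phi> s" "\<psi> s"] B s
      by (intro mult_left_mono) (auto simp: dist_norm d_def)
    finally have "d s \<bullet> ?D \<le> L * (d s \<bullet> d s)"
      by (simp add: power2_norm_eq_inner[symmetric] power2_eq_square algebra_simps)
    then show "\<exists>y. (u has_real_derivative y) (at s) \<and> y \<le> 0"
      using u by (auto intro!: exI mult_nonneg_nonpos)
  next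
    show "continuous_on {0..t} u"
      unfolding u_def d_def
      by (intro continuous_intros solves_upto_continuous[OF sol(1)] solves_upto_continuous[OF sol(2)])
  qed
  then have "d t \<bullet> d t \<le> exp (2 * L * t) * (d 0 \<bullet> d 0)"
    by (simp add: u_def exp_minus field_simps)
  also have "\<dots> = (exp (L * t) * norm (d 0))\<^sup>2"
    by (simp add: power_mult_distrib power2_norm_eq_inner exp_double[symmetric] algebra_simps)
  finally have "(norm (d t))\<^sup>2 \<le> (exp (L * t) * norm (d 0))\<^sup>2"
    by (simp add: power2_norm_eq_inner)
  then have "norm (d t) \<le> exp (L * t) * norm (d 0)"
    by (rule power2_le_imp_le) auto
  then show ?thesis by (simp add: d_def dist_norm)
qed

locale bounded_lipschitz_field =
  fixes F :: "'a::euclidean_space \<Rightarrow> 'a" and L M :: real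
  assumes lipschitz: "L-lipschitz_on UNIV F"
    and bound: "norm (F p) \<le> M"
begin

lemma L_nonneg: "0 \<le> L"
  by (rule lipschitz_on_nonneg[OF lipschitz])

lemma M_nonneg: "0 \<le> M"
  by (rule order_trans[OF norm_ge_zero bound])

lemma dist_le: "dist (F p) (F q) \<le> L * dist p q"
  by (rule lipschitz_onD[OF lipschitz]) auto

lemma continuous_field [continuous_intros]:
  "continuous_on S g \<Longrightarrow> continuous_on S (\<lambda>x. F (g x))"
  using continuous_on_compose2[OF lipschitz_on_continuous_on[OF lipschitz], of S g] by auto

text \<open>
  Picard's operator is a contraction on all of \<open>[0, \<infinity>)\<close> at once when the deviation from \<open>p\<close> is
  weighted by \<open>exp (- (2 * L + 1) * t)\<close>.
\<close>

lemma solution_exists: "\<exists>\<phi>. \<phi> 0 = p \<and> (\<forall>t. solves_upto F t \<phi>)"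
proof -
  \<comment> \<open>\<open>A > 2 * L\<close> makes the contraction factor \<open>L / A\<close> at
    most \<open>1 / 2\<close>; the summand 1 also gives \<open>1 \<le> A\<close>, on which the
    uniform bound for Picard's operator rests.\<close>
  define A where "A = 2 * L + 1"
  have A: "1 \<le> A" "0 < A" using L_nonneg by (auto simp: A_def)
  define P where "P = (\<lambda>(g :: real \<Rightarrow> 'a) t.
     exp (- A * t) *\<^sub>R integral {0..t} (\<lambda>s. F (p + exp (A * s) *\<^sub>R g s)))"
  have cont: "continuous_on S (\<lambda>s. F (p + exp (A * s) *\<^sub>R g s))" if "continuous_on S g" for S g
    by (intro continuous_intros that)
  have contP: "continuous_on UNIV (\<lambda>t. P g (max 0 t))" if g: "continuous_on UNIV g" for g
  proof -
    have "continuous_on {0..} (P g)"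
    proof (rule continuous_on_eq_continuous_within[THEN iffD2], rule ballI)
      fix t :: real assume t: "t \<in> {0..}"
      have "continuous_on {0..t + 1} (P g)"
        unfolding P_def
        by (intro continuous_intros indefinite_integral_continuous_1 integrable_continuous_real cont
            continuous_on_subset[OF g]) auto
      then have "continuous (at t within {0..t + 1}) (P g)"
        using t by (auto simp: continuous_on_eq_continuous_within)
      moreover have "at t within {0..t + 1} = at t within {0..}"
        using t by (intro at_within_nhd[of t "{..<t + 1}"]) auto
      ultimately show "continuous (at t within {0..}) (P g)" by simp
    qed
    then show ?thesis
      by (rule continuous_on_compose2) (auto intro!: continuous_intros)
  qed
  have boundP: "norm (P g t) \<le> M" if g: "continuous_on UNIV g" and t: "0 \<le> t" for g t
  proof -
    have "norm (integral {0..t} (\<lambda>s. F (p + exp (A * s) *\<^sub>R g s))) \<le> M * (t - 0)"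
      using t by (intro integral_bound cont continuous_on_subset[OF g] bound) auto
    then have "norm (P g t) \<le> exp (- A * t) * (M * t)"
      by (simp add: P_def)
    also have "\<dots> \<le> exp (- A * t) * (M * exp (A * t))"
    proof (intro mult_left_mono)
      have "t \<le> A * t" using A t by (simp add: mult_le_cancel_right1)
      also have "\<dots> \<le> exp (A * t)" using exp_ge_add_one_self[of "A * t"] by linarith
      finally show "t \<le> exp (A * t)" .
    qed (use M_nonneg in auto)
    also have "\<dots> = M" by (simp add: exp_minus)
    finally show ?thesis .
  qed
  \<comment> \<open>Bounded continuous functions live on the whole line, so the operator is
    continued to negative times by its value at 0.\<close>
  define R where "R = (\<lambda>g :: real \<Rightarrow>\<^sub>C 'a. Bcontfun (\<lambda>t. P (apply_bcontfun g) (max 0 t)))"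
  have R: "apply_bcontfun (R g) t = P (apply_bcontfun g) (max 0 t)" for g t
    unfolding R_def
    by (subst Bcontfun_inverse) (auto intro!: bcontfun_normI[of _ M] contP boundP)
  have "\<exists>!g. R g = g"
  proof (rule banach_fix_type)
    show "\<forall>g h. dist (R g) (R h) \<le> 1 / 2 * dist g h"
    proof (intro allI dist_bound)
      fix g h :: "real \<Rightarrow>\<^sub>C 'a" and t0 :: real
      define t where "t = max 0 t0"
      have t: "0 \<le> t" by (simp add: t_def)
      let ?G = "\<lambda>g s. F (p + exp (A * s) *\<^sub>R apply_bcontfun g s)"
      have int: "?G g integrable_on {0..t}" for g
        by (intro integrable_continuous_real cont) auto
      have exp_int: "((\<lambda>s. L * dist g h * exp (A * s)) has_integral
          L * dist g h * (exp (A * t) / A) - L * dist g h * (exp (A * 0) / A)) {0..t}"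
        using A t by (intro fundamental_theorem_of_calculus)
          (auto intro!: derivative_eq_intros simp: has_real_derivative_iff_has_vector_derivative[symmetric])
      have "norm (integral {0..t} (\<lambda>s. ?G g s - ?G h s)) \<le> integral {0..t} (\<lambda>s. L * dist g h * exp (A * s))"
      proof (rule integral_norm_bound_integral)
        show "norm (?G g s - ?G h s) \<le> L * dist g h * exp (A * s)" for s
        proof -
          have "norm (?G g s - ?G h s) \<le> L * dist (p + exp (A * s) *\<^sub>R apply_bcontfun g s) (p + exp (A * s) *\<^sub>R apply_bcontfun h s)"
            using dist_le[of "p + exp (A * s) *\<^sub>R apply_bcontfun g s" "p + exp (A * s) *\<^sub>R apply_bcontfun h s"]
            by (simp only: dist_norm)
          also have "\<dots> = L * (exp (A * s) * dist (apply_bcontfun g s) (apply_bcontfun h s))"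
            by (simp add: dist_norm scaleR_diff_right[symmetric])
          also have "\<dots> \<le> L * (exp (A * s) * dist g h)"
            by (intro mult_left_mono dist_bounded L_nonneg) auto
          finally show ?thesis by (simp add: algebra_simps)
        qed
      qed (use int exp_int in \<open>auto intro!: integrable_diff\<close>)
      also have "\<dots> \<le> L * dist g h * (exp (A * t) / A)"
        using exp_int A L_nonneg by (subst integral_unique[OF exp_int]) (simp add: field_simps)
      also have "\<dots> = L / A * dist g h * exp (A * t)" by (simp add: field_simps)
      finally have "norm (P g t - P h t) \<le> exp (- A * t) * (L / A * dist g h * exp (A * t))"
        unfolding P_def using int
        by (simp only: scaleR_diff_right[symmetric] integral_diff norm_scaleR abs_exp_cancel mult_left_mono exp_ge_zero)
      also have "\<dots> = L / A * dist g h" by (simp add: exp_minus)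
      also have "\<dots> \<le> 1 / 2 * dist g h"
        using A L_nonneg by (intro mult_right_mono) (auto simp: A_def field_simps)
      finally show "dist (apply_bcontfun (R g) t0) (apply_bcontfun (R h) t0) \<le> 1 / 2 * dist g h"
        by (simp add: R t_def[symmetric] dist_norm)
    qed
  qed auto
  then obtain g where g: "R g = g" by blast
  define \<phi> where "\<phi> = (\<lambda>t. p + exp (A * t) *\<^sub>R apply_bcontfun g t)"
  have \<phi>: "\<phi> t = p + integral {0..t} (\<lambda>s. F (\<phi> s))" if "0 \<le> t" for t
  proof -
    have "apply_bcontfun g t = P g t" using R[of g t] that by (simp add: g)
    then show ?thesis unfolding \<phi>_def P_def by (simp add: exp_minus)
  qed
  have "solves_upto F t \<phi>" for t
    unfolding solves_upto_def
  proof
    fix s assume s: "s \<in> {0..t}"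
    have "continuous_on {0..t} (\<lambda>s. F (\<phi> s))" unfolding \<phi>_def by (intro cont) auto
    from integral_has_vector_derivative[OF this s]
    have "((\<lambda>t. p + integral {0..t} (\<lambda>s. F (\<phi> s))) has_vector_derivative F (\<phi> s)) (at s within {0..t})"
      by (auto intro!: derivative_eq_intros)
    then show "(\<phi> has_vector_derivative F (\<phi> s)) (at s within {0..t})"
      using s \<phi> by (rule has_vector_derivative_transform[rotated 2]) auto
  qed
  moreover have "\<phi> 0 = p" using \<phi>[of 0] by simp
  ultimately show ?thesis by blast
qed

text \<open>One curve is chosen for all horizons at once. Only times \<open>t \<ge> 0\<close> are
  pinned down, because \<open>{0..t}\<close> is empty for negative \<open>t\<close>.\<close>

definition flow :: "'a \<Rightarrow> real \<Rightarrow> 'a" where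
  "flow p = (SOME \<phi>. \<phi> 0 = p \<and> (\<forall>t. solves_upto F t \<phi>))"

lemma flow_0 [simp]: "flow p 0 = p"
  and flow_solves: "solves_upto F t (flow p)"
  using someI_ex[OF solution_exists[of p]] by (auto simp: flow_def)

lemma flow_unique:
  assumes "solves_upto F t \<phi>" "\<phi> 0 = p" "0 \<le> t"
  shows "\<phi> t = flow p t"
  using gronwall_solutions[OF lipschitz assms(1) flow_solves[of t p] UNIV_I UNIV_I assms(3)] assms(2)
  by simp

lemma flow_add: 
  assumes "0 \<le> s" "0 \<le> t"
  shows "flow p (s + t) = flow (flow p s) t"
proof -
  have "solves_upto F t (\<lambda>r. flow p (r + s))"
    by (rule solves_upto_shift[OF flow_solves assms(1)])
  from flow_unique[OF this _ assms(2), of "flow p s"] show ?thesis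
    by (simp add: add.commute)
qed

lemma flow_dist:
  assumes "0 \<le> t"
  shows "dist (flow p t) (flow q t) \<le> exp (L * t) * dist p q"
  using gronwall_solutions[OF lipschitz flow_solves[of t p] flow_solves[of t q] UNIV_I UNIV_I assms]
  by simp

lemma flow_continuous: "continuous_on {0..} (flow p)"
proof (rule continuous_on_eq_continuous_within[THEN iffD2], rule ballI)
  fix t :: real assume t: "t \<in> {0..}"
  have "continuous (at t within {0..t + 1}) (flow p)"
    using t solves_upto_continuous[OF flow_solves[of "t + 1" p]] by (auto simp: continuous_on_eq_continuous_within)
  moreover have "at t within {0..t + 1} = at t within {0..}"
    using t by (intro at_within_nhd[of t "{..<t + 1}"]) auto
  ultimately show "continuous (at t within {0..}) (flow p)" by simp
qed

lemma flow_integral: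
  assumes "0 \<le> t"
  shows "((\<lambda>s. F (flow p s)) has_integral flow p t - p) {0..t}"
  using assms flow_solves[of t p] fundamental_theorem_of_calculus[of 0 t "flow p" "\<lambda>s. F (flow p s)"]
  unfolding solves_upto_def by simp

lemma flow_dist_start:
  assumes "0 \<le> t"
  shows "dist (flow p t) p \<le> M * t"
proof -
  have "((\<lambda>s. F (flow p s)) has_integral flow p t - p) (cbox 0 t)"
    using flow_integral[OF assms] by simp
  from has_integral_bound[OF M_nonneg this bound] show ?thesis
    using assms by (simp add: dist_norm)
qed

lemma flow_dist_time:
  assumes "0 \<le> s" "0 \<le> t"
  shows "dist (flow p s) (flow p t) \<le> M * \<bar>s - t\<bar>"
proof -
  have "dist (flow p s) (flow p t) \<le> M * (t - s)" if "0 \<le> s" "s \<le> t" for s t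
    using flow_dist_start[of "t - s" "flow p s"] flow_add[of s "t - s" p] that
    by (simp add: dist_commute)
  from this[of s t] this[of t s] show ?thesis using assms
    by (cases "s \<le> t") (auto simp: dist_commute)
qed

text \<open>The field changes by at most \<open>L * M * t\<close> along the curve, hence an error of
  second order. This allows straight segments to replace the flow when difference quotients are
  taken.\<close>

lemma flow_euler:
  assumes "0 \<le> t"
  shows "norm (flow p t - (p + t *\<^sub>R F p)) \<le> L * M * t\<^sup>2"
proof -
  have "((\<lambda>s. F (flow p s) - F p) has_integral flow p t - p - t *\<^sub>R F p) (cbox 0 t)"
    using has_integral_diff[OF flow_integral[OF assms] has_integral_const_real[of "F p" 0 t]] assms
    by simp
  from has_integral_bound[OF _ this, of "L * (M * t)"]
  have "norm (flow p t - p - t *\<^sub>R F p) \<le> L * (M * t) * t"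
  proof (rule order_trans)
    show "norm (F (flow p s) - F p) \<le> L * (M * t)" if s: "s \<in> cbox 0 t" for s
    proof -
      have "norm (F (flow p s) - F p) \<le> L * dist (flow p s) p" using dist_le by (simp add: dist_norm)
      also have "\<dots> \<le> L * (M * t)"
        using flow_dist_start[of s p] s mult_left_mono[OF _ M_nonneg, of s t]
        by (intro mult_left_mono L_nonneg) auto
      finally show ?thesis .
    qed
  qed (use assms L_nonneg M_nonneg in auto)
  then show ?thesis by (simp add: algebra_simps power2_eq_square)
qed

end

subsection \<open>Mollification of Lipschitz functions\<close>

text \<open>The first-order remainder is at most \<open>h\<^sup>2\<close> for every combination of
  signs. It makes the mollifying kernel continuously differentiable across the boundary of its
  support.\<close>

lemma DERIV_pos_part_square:
  "((\<lambda>t::real. (max 0 t)\<^sup>2) has_real_derivative 2 * max 0 t) (at t)"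
  unfolding DERIV_def
proof (rule LIM_zero_cancel, rule Lim_null_comparison)
  show "\<forall>\<^sub>F h in at 0. norm (((max 0 (t + h))\<^sup>2 - (max 0 t)\<^sup>2) / h - 2 * max 0 t) \<le> \<bar>h\<bar>"
    unfolding eventually_at_filter
  proof (intro always_eventually allI impI)
    fix h :: real assume "h \<noteq> 0"
    have "\<bar>(max 0 (t + h))\<^sup>2 - (max 0 t)\<^sup>2 - 2 * max 0 t * h\<bar> \<le> h\<^sup>2"
    proof (cases "0 \<le> t"; cases "0 \<le> t + h")
      assume t: "0 \<le> t" "\<not> 0 \<le> t + h"
      then have "t * (t + 2 * h) \<le> 0" by (intro mult_nonneg_nonpos) auto
      moreover have "0 \<le> (t + h)\<^sup>2" by simp
      ultimately show ?thesis using t by (simp add: power2_eq_square algebra_simps)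
    next
      assume t: "\<not> 0 \<le> t" "0 \<le> t + h"
      then have "(t + h)\<^sup>2 \<le> h\<^sup>2" by (intro power_mono) auto
      then show ?thesis using t by simp
    qed (auto simp: power2_eq_square algebra_simps)
    then have "\<bar>(max 0 (t + h))\<^sup>2 - (max 0 t)\<^sup>2 - 2 * max 0 t * h\<bar> / \<bar>h\<bar> \<le> \<bar>h\<bar>"
      using \<open>h \<noteq> 0\<close> by (simp add: field_simps power2_eq_square abs_mult_self_eq)
    then show "norm (((max 0 (t + h))\<^sup>2 - (max 0 t)\<^sup>2) / h - 2 * max 0 t) \<le> \<bar>h\<bar>"
      using \<open>h \<noteq> 0\<close> by (simp add: abs_divide[symmetric] diff_divide_distrib)
  qed
  show "(\<lambda>h::real. \<bar>h\<bar>) \<midarrow>0\<rightarrow> 0" by (auto intro!: tendsto_eq_intros)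
qed

text \<open>The substitution \<open>q = p + z\<close> moves \<open>p\<close> out of the merely
  Lipschitz function into the kernel, over a domain \<open>S\<close> that can be shared by nearby
  \<open>p\<close>; then one may differentiate under the integral. The two arguments of
  \<open>g\<close> stand for the shifted point and the kernel variable.\<close>

lemma integral_shift_support:
  fixes g :: "'a::euclidean_space \<Rightarrow> 'a \<Rightarrow> 'c::banach"
  assumes cont: "continuous_on UNIV (\<lambda>(q, z). g q z)"
    and supp: "\<And>q z. z \<notin> cbox (- k) k \<Longrightarrow> g q z = 0"
    and S: "cbox (p - k) (p + k) \<subseteq> S"
  shows "integral (cbox (- k) k) (\<lambda>z. g (p + z) z) = integral S (\<lambda>q. g q (q - p))"
proof -
  have "continuous_on UNIV (\<lambda>z. g (p + z) z)"
  proof -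
    have "continuous_on UNIV (\<lambda>z. (p + z, z))" by (intro continuous_intros)
    from continuous_on_compose2[OF cont this] show ?thesis by simp
  qed
  then have "(\<lambda>z. g (p + z) z) integrable_on cbox (- k) k"
    by (rule integrable_continuous[OF continuous_on_subset]) auto
  then have "((\<lambda>z. g (p + z) z) has_integral integral (cbox (- k) k) (\<lambda>z. g (p + z) z)) (cbox (- k) k)"
    by (rule integrable_integral)
  then have "((\<lambda>q. g q (q - p)) has_integral integral (cbox (- k) k) (\<lambda>z. g (p + z) z)) (cbox (p - k) (p + k))"
    using has_integral_shift_cbox_iff[of "\<lambda>q. g q (q - p)" p _ "- k" k]
    by (simp add: o_def add.commute)
  then have "((\<lambda>q. g q (q - p)) has_integral integral (cbox (- k) k) (\<lambda>z. g (p + z) z)) S"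
  proof (rule has_integral_on_superset[OF _ _ S])
    fix q assume "q \<notin> cbox (p - k) (p + k)"
    then have "q - p \<notin> cbox (- k) k" by (auto simp: mem_box algebra_simps)
    then show "g q (q - p) = 0" by (rule supp)
  qed
  then show ?thesis by (simp add: integral_unique)
qed

text \<open>Convolution with a C1 kernel supported in the ball of radius \<delta>. For the last
  property, lower bounds on the increments of \<open>V\<close> at all points near \<open>p\<close>
  are averaged, and the quadratic error disappears in the limit of the difference quotients.\<close>

lemma C1_smoothing:
  fixes V :: "'a::euclidean_space \<Rightarrow> real"
  assumes lip: "K-lipschitz_on UNIV V" and \<delta>: "0 < \<delta>"
  obtains v v' where
    "\<And>p. (v has_derivative blinfun_apply (v' p)) (at p)"
    "continuous_on UNIV v'"
    "\<And>p. \<bar>v p - V p\<bar> \<le> K * \<delta>"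
    "\<And>p u a C. (\<And>q h. dist p q \<le> \<delta> \<Longrightarrow> 0 < h \<Longrightarrow> h \<le> 1 \<Longrightarrow> a * h - C * h\<^sup>2 \<le> V (q + h *\<^sub>R u) - V q)
       \<Longrightarrow> a \<le> blinfun_apply (v' p) u"
proof -
  define k where "k = \<delta> *\<^sub>R (One :: 'a)"
  \<comment> \<open>The kernel is \<open>(m z)\<^sup>2 / Z\<close>. It vanishes off the ball of
    radius \<delta>; the cube \<open>Q\<close> around that ball is a convenient domain of
    integration.\<close>
  define m where "m = (\<lambda>z::'a. max 0 (\<delta>\<^sup>2 - z \<bullet> z))"
  define Q where "Q = cbox (- k) k"
  define Z where "Z = integral Q (\<lambda>z. (m z)\<^sup>2)"
  define v where "v = (\<lambda>p. integral Q (\<lambda>z. V (p + z) * (m z)\<^sup>2 / Z))"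
  \<comment> \<open>The gradient of \<open>(m (q - p))\<^sup>2\<close> with respect to
    \<open>p\<close> is \<open>4 * m (q - p)\<close> times \<open>q - p\<close>, and
    \<open>q - p\<close> is the kernel variable \<open>z\<close>.\<close>
  define v' where "v' = (\<lambda>p. integral Q (\<lambda>z. (V (p + z) * (4 * m z) / Z) *\<^sub>R blinfun_inner_left z))"
  have K: "0 \<le> K" by (rule lipschitz_on_nonneg[OF lip])
  have contV [continuous_intros]: "continuous_on S (\<lambda>x. V (g x))" if "continuous_on S g" for S and g :: "'b::topological_space \<Rightarrow> 'a"
    using continuous_on_compose2[OF lipschitz_on_continuous_on[OF lip] that] by auto
  have contm [continuous_intros]: "continuous_on S (\<lambda>x. m (g x))" if "continuous_on S g" for S and g :: "'b::topological_space \<Rightarrow> 'a"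
    unfolding m_def by (intro continuous_intros that)
  have m_zero: "m z = 0" if "\<delta> < norm z" for z
    using power_strict_mono[OF that, of 2] \<delta> by (simp add: m_def power2_norm_eq_inner)
  have m_supp: "m z = 0" if "z \<notin> cbox (- k) k" for z
  proof (rule m_zero, rule ccontr)
    assume "\<not> \<delta> < norm z"
    then have "\<bar>z \<bullet> b\<bar> \<le> \<delta>" if "b \<in> Basis" for b
      using Basis_le_norm[OF that, of z] by linarith
    then have "- \<delta> \<le> z \<bullet> b \<and> z \<bullet> b \<le> \<delta>" if "b \<in> Basis" for b
      using that by (metis abs_le_iff minus_le_iff)
    then show False using that by (auto simp: k_def mem_box)
  qed
  have "Z \<noteq> 0"
  proof
    assume "Z = 0"
    moreover have "0 \<in> Q" using \<delta> by (auto simp: Q_def k_def mem_box)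
    ultimately have "(m 0)\<^sup>2 = 0"
      unfolding Z_def Q_def using \<delta>
      by (subst (asm) integral_cbox_eq_0_iff)
        (auto simp: k_def box_ne_empty box_eq_empty intro!: continuous_intros)
    then show False using \<delta> by (simp add: m_def)
  qed
  moreover have "0 \<le> Z"
    unfolding Z_def Q_def by (intro integral_nonneg integrable_continuous continuous_intros) auto
  ultimately have Z: "0 < Z" by simp
  have int: "(\<lambda>z. g z * (m z)\<^sup>2 / Z) integrable_on Q" if "continuous_on UNIV g" for g
    unfolding Q_def by (intro integrable_continuous continuous_intros continuous_on_subset[OF that]) (use Z in auto)
  have Z1: "integral Q (\<lambda>z. c * (m z)\<^sup>2 / Z) = c" for c
    using Z by (simp add: Z_def[symmetric])
  have mono: "integral Q (\<lambda>z. g z * (m z)\<^sup>2 / Z) \<le> integral Q (\<lambda>z. h z * (m z)\<^sup>2 / Z)"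
    if "continuous_on UNIV g" "continuous_on UNIV h" "\<And>z. norm z \<le> \<delta> \<Longrightarrow> g z \<le> h z" for g h
  proof (rule integral_le[OF int int])
    fix z
    show "g z * (m z)\<^sup>2 / Z \<le> h z * (m z)\<^sup>2 / Z"
      using that(3)[of z] m_zero[of z] Z
      by (cases "norm z \<le> \<delta>") (auto intro!: divide_right_mono mult_right_mono)
  qed fact+
  have deriv: "(v has_derivative blinfun_apply (v' p0)) (at p0)" for p0
  proof -
    \<comment> \<open>Doubling the cube covers the supports around all \<open>p\<close> within
      \<delta> of \<open>p0\<close>, so that the domain of integration no longer depends on
      \<open>p\<close>.\<close>
    define S where "S = cbox (p0 - 2 *\<^sub>R k) (p0 + 2 *\<^sub>R k)"
    have sub: "cbox (p - k) (p + k) \<subseteq> S" if "p \<in> cball p0 \<delta>" for p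
    proof
      fix q assume "q \<in> cbox (p - k) (p + k)"
      moreover have "\<bar>(p - p0) \<bullet> b\<bar> \<le> \<delta>" if "b \<in> Basis" for b
        using Basis_le_norm[OF that, of "p - p0"] \<open>p \<in> cball p0 \<delta>\<close> by (simp add: dist_norm norm_minus_commute)
      ultimately show "q \<in> S"
        by (force simp: S_def mem_box k_def inner_diff_left inner_add_left abs_le_iff)
    qed
    have v: "v p = integral S (\<lambda>q. V q * (m (q - p))\<^sup>2 / Z)" if "p \<in> cball p0 \<delta>" for p
      unfolding v_def Q_def
      by (rule integral_shift_support[where g = "\<lambda>q z. V q * (m z)\<^sup>2 / Z"])
        (use sub[OF that] m_supp Z in \<open>auto intro!: continuous_intros simp: split_beta\<close>)
    have v': "v' p0 = integral S (\<lambda>q. (V q * (4 * m (q - p0)) / Z) *\<^sub>R blinfun_inner_left (q - p0))"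
      unfolding v'_def Q_def
      by (rule integral_shift_support[where g = "\<lambda>q z. (V q * (4 * m z) / Z) *\<^sub>R blinfun_inner_left z"])
        (use sub[of p0] \<delta> m_supp Z in \<open>auto intro!: continuous_intros simp: split_beta\<close>)
    have "((\<lambda>p. integral S (\<lambda>q. V q * (m (q - p))\<^sup>2 / Z)) has_derivative blinfun_apply (v' p0)) (at p0 within cball p0 \<delta>)"
      unfolding v' S_def
    proof (rule leibniz_rule)
      fix p q :: 'a
      have "((\<lambda>p. \<delta>\<^sup>2 - (q - p) \<bullet> (q - p)) has_derivative (\<lambda>h. 2 * ((q - p) \<bullet> h))) (at p)"
        by (auto intro!: derivative_eq_intros simp: inner_commute)
      from has_derivative_compose[OF this DERIV_pos_part_square[unfolded has_field_derivative_def]]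
      have "((\<lambda>p. (m (q - p))\<^sup>2) has_derivative (\<lambda>h. 4 * m (q - p) * ((q - p) \<bullet> h))) (at p)"
        by (simp add: m_def algebra_simps)
      from has_derivative_mult_right[OF this, of "V q / Z"]
      have "((\<lambda>p. V q * (m (q - p))\<^sup>2 / Z) has_derivative
          (\<lambda>h. V q / Z * (4 * m (q - p) * ((q - p) \<bullet> h)))) (at p)"
        by simp
      moreover have "(\<lambda>h. V q / Z * (4 * m (q - p) * ((q - p) \<bullet> h))) =
          blinfun_apply ((V q * (4 * m (q - p)) / Z) *\<^sub>R blinfun_inner_left (q - p))"
        by (simp add: fun_eq_iff blinfun.scaleR_left inner_commute)
      ultimately have "((\<lambda>p. V q * (m (q - p))\<^sup>2 / Z) has_derivative
          blinfun_apply ((V q * (4 * m (q - p)) / Z) *\<^sub>R blinfun_inner_left (q - p))) (at p)"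
        by simp
      then show "((\<lambda>p. V q * (m (q - p))\<^sup>2 / Z) has_derivative
          blinfun_apply ((V q * (4 * m (q - p)) / Z) *\<^sub>R blinfun_inner_left (q - p))) (at p within cball p0 \<delta>)"
        by (rule has_derivative_at_withinI)
    next
      show "(\<lambda>q. V q * (m (q - p))\<^sup>2 / Z) integrable_on cbox (p0 - 2 *\<^sub>R k) (p0 + 2 *\<^sub>R k)" for p
        using Z by (intro integrable_continuous continuous_intros) auto
      show "continuous_on (cball p0 \<delta> \<times> cbox (p0 - 2 *\<^sub>R k) (p0 + 2 *\<^sub>R k))
         (\<lambda>(p, q). (V q * (4 * m (q - p)) / Z) *\<^sub>R blinfun_inner_left (q - p))"
        using Z by (auto intro!: continuous_intros simp: split_beta)
    qed (use \<delta> in auto)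
    then have "(v has_derivative blinfun_apply (v' p0)) (at p0 within cball p0 \<delta>)"
      by (rule has_derivative_transform[rotated 2]) (use v \<delta> in auto)
    then show ?thesis
      using \<delta> by (subst (asm) at_within_interior) auto
  qed
  have cont: "continuous_on UNIV v'"
    unfolding v'_def Q_def
    using Z by (intro integral_continuous_on_param) (auto intro!: continuous_intros simp: split_beta)
  have near: "\<bar>V (p + z) - V p\<bar> \<le> K * \<delta>" if "norm z \<le> \<delta>" for p z
    using lipschitz_onD[OF lip, of "p + z" p] mult_left_mono[OF that K] by (simp add: dist_norm)
  have close: "\<bar>v p - V p\<bar> \<le> K * \<delta>" for p
  proof -
    have "v p \<le> integral Q (\<lambda>z. (V p + K * \<delta>) * (m z)\<^sup>2 / Z)"
      unfolding v_def by (intro mono continuous_intros) (use near[of _ p] in \<open>auto simp: abs_le_iff algebra_simps\<close>)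
    moreover have "integral Q (\<lambda>z. (V p - K * \<delta>) * (m z)\<^sup>2 / Z) \<le> v p"
      unfolding v_def
    proof (intro mono continuous_intros)
      fix z :: 'a assume "norm z \<le> \<delta>"
      from near[OF this, of p] show "V p - K * \<delta> \<le> V (p + z)" by linarith
    qed
    ultimately show ?thesis unfolding Z1 by (simp add: abs_le_iff)
  qed
  have "a \<le> blinfun_apply (v' p) u"
    if *: "\<And>q h. dist p q \<le> \<delta> \<Longrightarrow> 0 < h \<Longrightarrow> h \<le> 1 \<Longrightarrow> a * h - C * h\<^sup>2 \<le> V (q + h *\<^sub>R u) - V q" for p u a C
  proof -
    have quotient: "a - C * h \<le> (v (p + h *\<^sub>R u) - v p) / h" if h: "0 < h" "h \<le> 1" for h
    proof -
      have "integral Q (\<lambda>z. (a * h - C * h\<^sup>2) * (m z)\<^sup>2 / Z)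
          \<le> integral Q (\<lambda>z. (V (p + h *\<^sub>R u + z) - V (p + z)) * (m z)\<^sup>2 / Z)"
      proof (intro mono continuous_intros)
        fix z :: 'a assume "norm z \<le> \<delta>"
        then show "a * h - C * h\<^sup>2 \<le> V (p + h *\<^sub>R u + z) - V (p + z)"
          using *[of "p + z" h] h by (simp add: dist_norm algebra_simps)
      qed
      also have "\<dots> = integral Q (\<lambda>z. V (p + h *\<^sub>R u + z) * (m z)\<^sup>2 / Z - V (p + z) * (m z)\<^sup>2 / Z)"
        by (simp add: algebra_simps diff_divide_distrib)
      also have "\<dots> = v (p + h *\<^sub>R u) - v p"
        unfolding v_def by (intro integral_diff int continuous_intros)
      finally have "a * h - C * h\<^sup>2 \<le> v (p + h *\<^sub>R u) - v p" unfolding Z1 .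
      then show ?thesis using h by (simp add: field_simps power2_eq_square)
    qed
    have "((\<lambda>h. p + h *\<^sub>R u) has_derivative (\<lambda>h. h *\<^sub>R u)) (at (0::real))"
      by (auto intro!: derivative_eq_intros)
    from has_derivative_compose[OF this, of v "blinfun_apply (v' p)"]
    have "((\<lambda>h. v (p + h *\<^sub>R u)) has_real_derivative blinfun_apply (v' p) u) (at 0)"
      using deriv[of p] unfolding has_field_derivative_def
      by (simp add: blinfun.scaleR_right mult.commute[of _ "blinfun_apply (v' p) u"] fun_eq_iff)
    then have "((\<lambda>h. (v (p + h *\<^sub>R u) - v p) / h) \<longlongrightarrow> blinfun_apply (v' p) u) (at_right 0)"
      using tendsto_mono[OF at_le[of "{0<..}" UNIV "0::real"]] by (simp add: DERIV_def)
    moreover have "((\<lambda>h. a - C * h) \<longlongrightarrow> a - C * 0) (at_right 0)"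
      by (intro tendsto_intros)
    moreover have "\<forall>\<^sub>F h in at_right 0. a - C * h \<le> (v (p + h *\<^sub>R u) - v p) / h"
      unfolding eventually_at_right_field by (rule exI[of _ 1]) (simp add: quotient)
    ultimately have "a - C * 0 \<le> blinfun_apply (v' p) u"
      by (rule tendsto_le[OF trivial_limit_at_right_real])
    then show ?thesis by simp
  qed
  with deriv cont close show thesis by (rule that)
qed

subsection \<open>The penalised value function\<close>

lemma lipschitz_on_INF:
  fixes g :: "'i \<Rightarrow> 'a::metric_space \<Rightarrow> real"
  assumes "I \<noteq> {}"
    and lip: "\<And>i. i \<in> I \<Longrightarrow> C-lipschitz_on S (g i)"
    and bdd: "\<And>x. x \<in> S \<Longrightarrow> bdd_below ((\<lambda>i. g i x) ` I)"
  shows "C-lipschitz_on S (\<lambda>x. INF i\<in>I. g i x)"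
proof (rule lipschitz_onI)
  show "0 \<le> C" using assms(1) lip lipschitz_on_nonneg by blast
  have le: "(INF i\<in>I. g i x) \<le> (INF i\<in>I. g i y) + C * dist x y" if "x \<in> S" "y \<in> S" for x y
  proof -
    have "(INF i\<in>I. g i x) - C * dist x y \<le> (INF i\<in>I. g i y)"
    proof (rule cINF_greatest[OF assms(1)])
      fix i assume i: "i \<in> I"
      have "(INF i\<in>I. g i x) \<le> g i x" by (rule cINF_lower[OF bdd[OF that(1)] i])
      also have "\<dots> \<le> g i y + C * dist x y"
        using lipschitz_onD[OF lip[OF i] that] by (simp add: dist_real_def)
      finally show "(INF i\<in>I. g i x) - C * dist x y \<le> g i y" by simp
    qed
    then show ?thesis by simp
  qed
  show "dist (INF i\<in>I. g i x) (INF i\<in>I. g i y) \<le> C * dist x y" if "x \<in> S" "y \<in> S" for x y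
    using le[OF that] le[OF that(2,1)] by (simp add: dist_real_def abs_le_iff dist_commute)
qed

context bounded_lipschitz_field
begin

definition penalty :: "'a set \<Rightarrow> 'a \<Rightarrow> real \<Rightarrow> real" where
  "penalty Q p s = integral {0..s} (\<lambda>r. infdist (flow p r) Q)"

text \<open>The value of an optimal stopping problem with terminal cost \<open>W\<close> and running
  cost \<open>K\<close> times the distance to \<open>Q\<close>. The finite horizon \<open>S\<close>
  keeps the Lipschitz constant finite.\<close>

definition penalised_value :: "'a set \<Rightarrow> ('a \<Rightarrow> real) \<Rightarrow> real \<Rightarrow> real \<Rightarrow> 'a \<Rightarrow> real" where
  "penalised_value Q W K S p = (INF s\<in>{0..S}. W (flow p s) + K * penalty Q p s)"

lemma infdist_flow_continuous: "continuous_on {0..} (\<lambda>r. infdist (flow p r) Q)"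
  by (intro continuous_intros flow_continuous)

lemma infdist_flow_integrable:
  "0 \<le> a \<Longrightarrow> (\<lambda>r. infdist (flow p r) Q) integrable_on {a..b}"
  by (rule integrable_continuous_real[OF continuous_on_subset[OF infdist_flow_continuous]]) auto

lemma penalty_nonneg: "0 \<le> penalty Q p s"
  unfolding penalty_def by (intro integral_nonneg infdist_flow_integrable) (auto simp: infdist_nonneg)

lemma penalty_add:
  assumes "0 \<le> h" "0 \<le> s"
  shows "penalty Q p (h + s) = penalty Q p h + penalty Q (flow p h) s"
proof -
  have "penalty Q p (h + s) = penalty Q p h + integral {h..h + s} (\<lambda>r. infdist (flow p r) Q)"
    unfolding penalty_def
    by (rule Henstock_Kurzweil_Integration.integral_combine[symmetric])
      (use assms infdist_flow_integrable in auto)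
  also have "integral {h..h + s} (\<lambda>r. infdist (flow p r) Q)
      = integral {0..s} (\<lambda>r. infdist (flow p (h + r)) Q)"
    using integral_shift_cbox_plus[of 0 s "\<lambda>r. infdist (flow p r) Q" h]
    by (simp add: o_def add.commute)
  also have "\<dots> = penalty Q (flow p h) s"
    unfolding penalty_def using assms by (intro integral_cong) (auto simp: flow_add)
  finally show ?thesis .
qed

lemma penalty_mono:
  assumes "0 \<le> s" "s \<le> t"
  shows "penalty Q p s \<le> penalty Q p t"
  using penalty_add[of s "t - s" Q p] penalty_nonneg[of Q "flow p s" "t - s"] assms by simp

lemma exp_L_mono: "s \<le> t \<Longrightarrow> exp (L * s) \<le> exp (L * t)"
  using L_nonneg by (simp add: mult_left_mono)

lemma penalty_lipschitz:
  assumes "0 \<le> s" "s \<le> S"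
  shows "(S * exp (L * S))-lipschitz_on UNIV (\<lambda>p. penalty Q p s)"
proof (rule lipschitz_onI)
  fix p q
  have "norm (integral {0..s} (\<lambda>r. infdist (flow p r) Q - infdist (flow q r) Q))
      \<le> exp (L * S) * dist p q * (s - 0)"
  proof (rule integral_bound)
    show "continuous_on {0..s} (\<lambda>r. infdist (flow p r) Q - infdist (flow q r) Q)"
      by (intro continuous_on_diff continuous_on_subset[OF infdist_flow_continuous]) auto
    fix r assume r: "r \<in> {0..s}"
    have "\<bar>infdist (flow p r) Q - infdist (flow q r) Q\<bar> \<le> dist (flow p r) (flow q r)"
      by (rule infdist_triangle_abs)
    also have "\<dots> \<le> exp (L * r) * dist p q" using r by (intro flow_dist) auto
    also have "\<dots> \<le> exp (L * S) * dist p q"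
      using r assms by (intro mult_right_mono exp_L_mono) auto
    finally show "norm (infdist (flow p r) Q - infdist (flow q r) Q) \<le> exp (L * S) * dist p q"
      by simp
  qed (use assms in auto)
  then have "dist (penalty Q p s) (penalty Q q s) \<le> exp (L * S) * dist p q * s"
    unfolding penalty_def by (simp add: integral_diff infdist_flow_integrable dist_real_def)
  also have "\<dots> \<le> exp (L * S) * dist p q * S" using assms by (intro mult_left_mono) auto
  finally show "dist (penalty Q p s) (penalty Q q s) \<le> S * exp (L * S) * dist p q"
    by (simp add: algebra_simps)
qed (use assms in auto)

text \<open>A curve of speed at most \<open>M\<close> started at \<open>q\<close> stays within
  \<open>dist p q + M * h\<close> of \<open>p\<close> up to time \<open>h\<close>. For
  \<open>q\<close> close to a point of \<open>Q\<close> the penalty is thus a small multiple of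
  \<open>h\<close>, which is why the subsolution inequality is obtained on \<open>Q\<close>.\<close>

lemma penalty_short:
  assumes "p \<in> Q" "0 \<le> h"
  shows "penalty Q q h \<le> (dist p q + M * h) * h"
proof -
  have "penalty Q q h \<le> integral {0..h} (\<lambda>r. dist p q + M * h)"
    unfolding penalty_def
  proof (intro integral_le infdist_flow_integrable)
    fix r assume r: "r \<in> {0..h}"
    have "infdist (flow q r) Q \<le> dist (flow q r) p" by (rule infdist_le[OF assms(1)])
    also have "\<dots> \<le> dist (flow q r) q + dist q p" by (rule dist_triangle)
    also have "dist (flow q r) q \<le> M * r" using r by (intro flow_dist_start) auto
    also have "M * r \<le> M * h" using r by (intro mult_left_mono M_nonneg) auto
    finally show "infdist (flow q r) Q \<le> dist p q + M * h" by (simp add: dist_commute)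
  qed auto
  then show ?thesis using assms by (simp add: mult.commute)
qed

lemma penalty_unit_ge:
  assumes "\<And>r. r \<in> {0..1} \<Longrightarrow> 1 \<le> infdist (flow p r) Q"
  shows "1 \<le> penalty Q p 1"
proof -
  have "integral {0..1} (\<lambda>_::real. 1::real) \<le> penalty Q p 1"
    unfolding penalty_def using assms by (intro integral_le infdist_flow_integrable) auto
  then show ?thesis by simp
qed

lemma penalised_value_bdd_below:
  assumes "\<And>p. m \<le> W p" "0 \<le> K"
  shows "bdd_below ((\<lambda>s. W (flow p s) + K * penalty Q p s) ` {0..S})"
  using assms penalty_nonneg by (intro bdd_belowI[of _ m]) (auto intro!: add_increasing2)

lemma penalised_value_le:
  assumes "\<And>p. m \<le> W p" "0 \<le> K" "s \<in> {0..S}"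
  shows "penalised_value Q W K S p \<le> W (flow p s) + K * penalty Q p s"
  unfolding penalised_value_def by (intro cINF_lower penalised_value_bdd_below[where m = m] assms)

lemma penalised_value_le_self:
  assumes "\<And>p. m \<le> W p" "0 \<le> K" "0 \<le> S"
  shows "penalised_value Q W K S p \<le> W p"
  using penalised_value_le[of m W K 0 S Q p] assms by (simp add: penalty_def)

lemma penalised_value_lipschitz:
  assumes W: "C-lipschitz_on UNIV W" "\<And>p. m \<le> W p" and "0 \<le> K" "0 \<le> S"
  shows "(C * exp (L * S) + K * (S * exp (L * S)))-lipschitz_on UNIV (penalised_value Q W K S)"
  unfolding penalised_value_def
proof (rule lipschitz_on_INF)
  fix s assume s: "s \<in> {0..S}"
  have "(exp (L * S))-lipschitz_on UNIV (\<lambda>p. flow p s)"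
  proof (rule lipschitz_onI)
    fix p q
    have "dist (flow p s) (flow q s) \<le> exp (L * s) * dist p q" using s by (intro flow_dist) auto
    also have "\<dots> \<le> exp (L * S) * dist p q" using s by (intro mult_right_mono exp_L_mono) auto
    finally show "dist (flow p s) (flow q s) \<le> exp (L * S) * dist p q" .
  qed auto
  then have "(C * exp (L * S))-lipschitz_on UNIV (\<lambda>p. W (flow p s))"
    by (rule lipschitz_on_compose2[OF _ lipschitz_on_subset[OF W(1)]]) auto
  moreover have "(\<bar>K\<bar> * (S * exp (L * S)))-lipschitz_on UNIV (\<lambda>p. K * penalty Q p s)"
    using s by (intro lipschitz_on_cmult_real penalty_lipschitz) auto
  ultimately show "(C * exp (L * S) + K * (S * exp (L * S)))-lipschitz_on UNIV
      (\<lambda>p. W (flow p s) + K * penalty Q p s)"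
    using lipschitz_on_add \<open>0 \<le> K\<close> by fastforce
qed (use assms penalised_value_bdd_below[OF W(2)] in auto)

text \<open>
  Horizons beyond \<open>S\<close> never matter: by then the penalty exceeds the oscillation of \<open>W\<close>, so that
  stopping immediately is cheaper.
\<close>

lemma penalised_value_flow:
  assumes W: "\<And>p. m \<le> W p" "\<And>p. W p \<le> m'"
    and K: "0 \<le> K" "m' - m \<le> K" and "0 \<le> S"
    and exit: "\<And>p. 1 \<le> penalty Q p S" and "0 \<le> h"
  shows "penalised_value Q W K S p \<le> penalised_value Q W K S (flow p h) + K * penalty Q p h"
proof -
  have "penalised_value Q W K S p - K * penalty Q p h \<le> penalised_value Q W K S (flow p h)"
    unfolding penalised_value_def[of Q W K S "flow p h"]
  proof (rule cINF_greatest)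
    fix s assume s: "s \<in> {0..S}"
    have "penalised_value Q W K S p \<le> W (flow p (h + s)) + K * penalty Q p (h + s)"
    proof (cases "h + s \<le> S")
      case True
      then show ?thesis using s \<open>0 \<le> h\<close> W(1) K(1) by (intro penalised_value_le[where m = m]) auto
    next
      case False
      have "penalised_value Q W K S p \<le> m'"
        using penalised_value_le_self[of m W K S Q p] W K \<open>0 \<le> S\<close> by (meson order_trans)
      also have "\<dots> \<le> m + K * 1" using K by simp
      also have "\<dots> \<le> W (flow p (h + s)) + K * penalty Q p (h + s)"
        using W(1) exit[of p] penalty_mono[of S "h + s" Q p] False K \<open>0 \<le> S\<close>
        by (intro add_mono mult_left_mono) auto
      finally show ?thesis .
    qed
    then show "penalised_value Q W K S p - K * penalty Q p h
        \<le> W (flow (flow p h) s) + K * penalty Q (flow p h) s"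
      using s \<open>0 \<le> h\<close> by (simp add: flow_add penalty_add algebra_simps)
  qed (use \<open>0 \<le> S\<close> in auto)
  then show ?thesis by simp
qed

text \<open>The dynamic programming inequality bounds increments of the value along the flow from
  below. Near \<open>Q\<close> the penalty in it is small, and replacing the flow by a straight step
  costs a second-order term and a term proportional to \<delta>; the mollification turns this into a
  bound on the derivative.\<close>

lemma smooth_subsolution:
  assumes W: "C-lipschitz_on UNIV W" "\<And>p. m \<le> W p" "\<And>p. W p \<le> m'"
    and K: "0 \<le> K" "m' - m \<le> K" and S: "0 \<le> S"
    and exit: "\<And>p. 1 \<le> penalty Q p S" and "0 < e"
  obtains v v' where
    "\<And>p. (v has_derivative blinfun_apply (v' p)) (at p)"
    "continuous_on UNIV v'"
    "\<And>p. \<bar>v p - penalised_value Q W K S p\<bar> \<le> e"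
    "\<And>p. p \<in> Q \<Longrightarrow> - e \<le> blinfun_apply (v' p) (F p)"
proof -
  let ?V = "penalised_value Q W K S"
  define D where "D = C * exp (L * S) + K * (S * exp (L * S))"
  have D: "D-lipschitz_on UNIV ?V"
    unfolding D_def by (rule penalised_value_lipschitz[OF W(1,2) K(1) S])
  then have D_nonneg: "0 \<le> D" by (rule lipschitz_on_nonneg)
  \<comment> \<open>\<open>D * \<delta>\<close> bounds the distance between \<open>v\<close> and the
    value function; \<open>K * \<delta>\<close> comes from the penalty near \<open>Q\<close>, and
    \<open>D * L * \<delta>\<close> from evaluating the field at \<open>p\<close> instead of
    \<open>q\<close>. The summand 1 keeps \<open>B\<close> positive.\<close>
  define B where "B = D + K + D * L + 1"
  have B: "0 < B" "D \<le> B" "K + D * L \<le> B"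
    using D_nonneg K(1) L_nonneg by (auto simp: B_def intro!: add_nonneg_pos)
  define \<delta> where "\<delta> = e / B"
  have \<delta>: "0 < \<delta>" using B \<open>0 < e\<close> by (simp add: \<delta>_def)
  have e: "e = B * \<delta>" using B by (simp add: \<delta>_def)
  obtain v v' where v: "\<And>p. (v has_derivative blinfun_apply (v' p)) (at p)"
    "continuous_on UNIV v'"
    "\<And>p. \<bar>v p - ?V p\<bar> \<le> D * \<delta>"
    "\<And>p u a C. (\<And>q h. dist p q \<le> \<delta> \<Longrightarrow> 0 < h \<Longrightarrow> h \<le> 1 \<Longrightarrow> a * h - C * h\<^sup>2 \<le> ?V (q + h *\<^sub>R u) - ?V q)
       \<Longrightarrow> a \<le> blinfun_apply (v' p) u"
    by (rule C1_smoothing[OF D \<delta>]) blast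
  show thesis
  proof (rule that[OF v(1,2)])
    show "\<bar>v p - ?V p\<bar> \<le> e" for p
      using order_trans[OF v(3) mult_right_mono[OF B(2)]] \<delta> by (simp add: e)
    fix p assume p: "p \<in> Q"
    have "- ((K + D * L) * \<delta>) \<le> blinfun_apply (v' p) (F p)"
    proof (rule v(4))
      fix q and h :: real assume q: "dist p q \<le> \<delta>" and h: "0 < h" "h \<le> 1"
      have "?V q \<le> ?V (flow q h) + K * penalty Q q h"
        by (rule penalised_value_flow[OF W(2,3) K S exit]) (use h in auto)
      also have "K * penalty Q q h \<le> K * ((\<delta> + M * h) * h)"
      proof (intro mult_left_mono K(1))
        have "penalty Q q h \<le> (dist p q + M * h) * h" using p h by (intro penalty_short) auto
        also have "\<dots> \<le> (\<delta> + M * h) * h" using q h by (intro mult_right_mono) auto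
        finally show "penalty Q q h \<le> (\<delta> + M * h) * h" .
      qed
      \<comment> \<open>The mollification lemma asks for one direction common to all
        \<open>q\<close> near \<open>p\<close>, hence the step along \<open>F p\<close> rather than
        \<open>F q\<close>.\<close>
      also have "?V (flow q h) \<le> ?V (q + h *\<^sub>R F p) + D * (L * M * h\<^sup>2 + h * (L * \<delta>))"
      proof -
        have "dist (flow q h) (q + h *\<^sub>R F p) \<le> norm (flow q h - (q + h *\<^sub>R F q)) + norm (h *\<^sub>R (F q - F p))"
          using norm_triangle_ineq[of "flow q h - (q + h *\<^sub>R F q)" "h *\<^sub>R (F q - F p)"]
          by (simp add: dist_norm algebra_simps)
        also have "\<dots> \<le> L * M * h\<^sup>2 + h * (L * \<delta>)"
        proof (rule add_mono[OF flow_euler])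
          have "norm (F q - F p) \<le> L * dist q p" using dist_le[of q p] by (simp add: dist_norm)
          also have "\<dots> \<le> L * \<delta>" using q by (intro mult_left_mono L_nonneg) (auto simp: dist_commute)
          finally show "norm (h *\<^sub>R (F q - F p)) \<le> h * (L * \<delta>)" using h by simp
        qed (use h in auto)
        finally have "D * dist (flow q h) (q + h *\<^sub>R F p) \<le> D * (L * M * h\<^sup>2 + h * (L * \<delta>))"
          by (rule mult_left_mono[OF _ D_nonneg])
        then show ?thesis
          using lipschitz_onD[OF D, of "flow q h" "q + h *\<^sub>R F p"] by (simp add: dist_real_def)
      qed
      finally show "- ((K + D * L) * \<delta>) * h - (K * M + D * L * M) * h\<^sup>2 \<le> ?V (q + h *\<^sub>R F p) - ?V q"
        by (simp add: algebra_simps power2_eq_square)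
    qed
    then show "- e \<le> blinfun_apply (v' p) (F p)"
      using order_trans[OF le_imp_neg_le[OF mult_right_mono[OF B(3)]]] \<delta> by (simp add: e)
  qed
qed

text \<open>Gronwall controls the starting point and the speed bound controls the time; the common
  bound \<open>S\<close> on the times makes the Gronwall factor uniform.\<close>

lemma flow_tendsto:
  assumes "p \<longlonglongrightarrow> p'" "s \<longlonglongrightarrow> s'" "\<And>n. s n \<in> {0..S}" "0 \<le> s'"
  shows "(\<lambda>n. flow (p n) (s n)) \<longlonglongrightarrow> flow p' s'"
proof (rule metric_tendsto_imp_tendsto)
  show "(\<lambda>n. exp (L * S) * dist (p n) p' + M * \<bar>s n - s'\<bar>) \<longlonglongrightarrow> 0"
    using assms(1,2) by (auto intro!: tendsto_eq_intros)
  show "\<forall>\<^sub>F n in sequentially. dist (flow (p n) (s n)) (flow p' s')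
      \<le> dist (exp (L * S) * dist (p n) p' + M * \<bar>s n - s'\<bar>) 0"
  proof (rule always_eventually, rule allI)
    fix n
    have "dist (flow (p n) (s n)) (flow p' s')
        \<le> dist (flow (p n) (s n)) (flow p' (s n)) + dist (flow p' (s n)) (flow p' s')"
      by (rule dist_triangle)
    also have "\<dots> \<le> exp (L * s n) * dist (p n) p' + M * \<bar>s n - s'\<bar>"
      using assms(3)[of n] assms(4) by (intro add_mono flow_dist flow_dist_time) auto
    also have "\<dots> \<le> exp (L * S) * dist (p n) p' + M * \<bar>s n - s'\<bar>"
      using assms(3)[of n] by (intro add_mono mult_right_mono exp_L_mono) auto
    finally show "dist (flow (p n) (s n)) (flow p' s')
        \<le> dist (exp (L * S) * dist (p n) p' + M * \<bar>s n - s'\<bar>) 0"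
      by simp
  qed
qed

text \<open>The penalty is Lipschitz in the starting point and continuous in time, so it vanishes
  for the limit curve, and a continuous nonnegative integrand with zero integral is zero. For
  \<open>s' = 0\<close> the integral carries no information and \<open>p' \<in> Q\<close> takes its
  place.\<close>

lemma flow_in_of_penalty_tendsto_0:
  assumes p: "p \<longlonglongrightarrow> p'" and s: "s \<longlonglongrightarrow> s'" "\<And>n. s n \<in> {0..S}" "0 \<le> s'"
    and pen: "(\<lambda>n. penalty Q (p n) (s n)) \<longlonglongrightarrow> 0"
    and Q: "closed Q" "Q \<noteq> {}" and p': "p' \<in> Q" and r: "r \<in> {0..s'}"
  shows "flow p' r \<in> Q"
proof -
  have "continuous_on {0..S} (penalty Q p')"
    unfolding penalty_def by (intro indefinite_integral_continuous_1 infdist_flow_integrable) auto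
  moreover have "s' \<in> {0..S}"
    using closed_sequentially[OF closed_atLeastAtMost _ s(1)] s(2) by blast
  ultimately have 1: "(\<lambda>n. penalty Q p' (s n)) \<longlonglongrightarrow> penalty Q p' s'"
    using s(1,2) by (auto elim!: continuous_on_tendsto_compose)
  have 2: "(\<lambda>n. penalty Q p' (s n)) \<longlonglongrightarrow> 0"
  proof (rule metric_tendsto_imp_tendsto)
    show "(\<lambda>n. penalty Q (p n) (s n) + S * exp (L * S) * dist (p n) p') \<longlonglongrightarrow> 0"
      using pen p by (auto intro!: tendsto_eq_intros)
    show "\<forall>\<^sub>F n in sequentially. dist (penalty Q p' (s n)) 0
        \<le> dist (penalty Q (p n) (s n) + S * exp (L * S) * dist (p n) p') 0"
    proof (rule always_eventually, rule allI)
      fix n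
      have "\<bar>penalty Q p' (s n) - penalty Q (p n) (s n)\<bar> \<le> S * exp (L * S) * dist (p n) p'"
        using lipschitz_onD[OF penalty_lipschitz[of "s n" S Q], of p' "p n"] s(2)[of n]
        by (simp add: dist_real_def dist_commute)
      then show "dist (penalty Q p' (s n)) 0
        \<le> dist (penalty Q (p n) (s n) + S * exp (L * S) * dist (p n) p') 0"
        using penalty_nonneg[of Q p' "s n"] by (simp add: dist_real_def)
    qed
  qed
  have zero: "integral {0..s'} (\<lambda>r. infdist (flow p' r) Q) = 0"
    using LIMSEQ_unique[OF 1 2] by (simp add: penalty_def)
  show ?thesis
  proof (cases "s' = 0")
    case True
    then show ?thesis using r p' by simp
  next
    case False
    then have "infdist (flow p' r) Q = 0"
      using zero r s(3) integral_cbox_eq_0_iff[of 0 s' "\<lambda>r. infdist (flow p' r) Q"]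
        continuous_on_subset[OF infdist_flow_continuous, of "{0..s'}" p' Q]
      by (auto simp: infdist_nonneg)
    then show ?thesis using in_closed_iff_infdist_zero[OF Q] by simp
  qed
qed

end

subsection \<open>Trajectories and weak duality\<close>

lemma locally_lipschitz_on_compact:
  assumes "locally_lipschitz_on S g" "compact B" "B \<subseteq> S"
  obtains L where "L-lipschitz_on B g"
proof -
  \<comment> \<open>The compactness result concerns time-dependent maps; a one-point time set turns
    \<open>g\<close> into such a map.\<close>
  have "local_lipschitz {0::real} B (\<lambda>_. g)"
    unfolding local_lipschitz_def
  proof (intro ballI)
    fix p t assume "p \<in> B"
    with assms obtain u L where u: "u > 0" "L-lipschitz_on (cball p u \<inter> S) g"
      unfolding locally_lipschitz_on_def by blast
    from u(2) have "L-lipschitz_on (cball p u \<inter> B) g"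
      by (rule lipschitz_on_subset) (use assms in auto)
    with u(1) show "\<exists>u>0. \<exists>L. \<forall>t\<in>cball t u \<inter> {0}. L-lipschitz_on (cball p u \<inter> B) g"
      by blast
  qed
  from local_lipschitz_compact_implies_lipschitz[OF this assms(2)] that show thesis
    by auto
qed

text \<open>Time becomes a coordinate running at unit speed, which makes the field
  autonomous.\<close>

definition augmented :: "(real \<Rightarrow> 'a \<Rightarrow> 'a) \<Rightarrow> real \<times> 'a \<Rightarrow> real \<times> 'a" where
  "augmented f = (\<lambda>(t, x). (1, f t x))"

lemma augmented_lipschitz:
  assumes "L-lipschitz_on B (\<lambda>(t, x). f t x)"
  shows "L-lipschitz_on B (augmented f)"
proof (rule lipschitz_onI)
  fix p q assume "p \<in> B" "q \<in> B"
  from lipschitz_onD[OF assms this] show "dist (augmented f p) (augmented f q) \<le> L * dist p q"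
    by (simp add: augmented_def split_beta dist_Pair_Pair)
qed (rule lipschitz_on_nonneg[OF assms])

lemma solution_upto_augmented:
  assumes "solution_upto f x0 t \<phi>"
  shows "solves_upto (augmented f) t (\<lambda>s. (s, \<phi> s))"
  using assms unfolding solution_upto_def solves_upto_def augmented_def
  by (auto intro!: has_vector_derivative_Pair has_vector_derivative_id)

lemma solution_upto_subset:
  assumes "solution_upto f x0 t \<phi>" "s \<le> t"
  shows "solution_upto f x0 s \<phi>"
  unfolding solution_upto_def
proof (intro conjI ballI)
  show "\<phi> 0 = x0" using assms by (simp add: solution_upto_def)
  fix r assume "r \<in> {0..s}"
  then show "(\<phi> has_vector_derivative f r (\<phi> r)) (at r within {0..s})"
    using assms unfolding solution_upto_def
    by (intro has_vector_derivative_within_subset[where S = "{0..t}" and T = "{0..s}"]) auto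
qed

lemma solution_upto_continuous:
  "solution_upto f x0 t \<phi> \<Longrightarrow> continuous_on {0..t} \<phi>"
  unfolding solution_upto_def by (intro continuous_on_vector_derivative) auto

context
  fixes f :: "real \<Rightarrow> real^'n \<Rightarrow> real^'n" and T :: real
  assumes f_lip: "locally_lipschitz_on ({0..T} \<times> UNIV) (\<lambda>(t, x). f t x)"
begin

text \<open>Both graphs lie in a compact set, where a single Lipschitz constant is available;
  Gronwall then applies to the augmented curves, which start at the same point.\<close>

lemma solution_upto_unique:
  assumes \<phi>: "solution_upto f x0 t \<phi>" and \<psi>: "solution_upto f x0 t \<psi>" and t: "t \<in> {0..T}"
  shows "\<phi> t = \<psi> t"
proof -
  define B where "B = {0..T} \<times> (\<phi> ` {0..t} \<union> \<psi> ` {0..t})"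
  have "compact B"
    unfolding B_def
    by (intro compact_Times compact_Un compact_continuous_image solution_upto_continuous[OF \<phi>]
        solution_upto_continuous[OF \<psi>] compact_Icc)
  then obtain L where "L-lipschitz_on B (\<lambda>(t, x). f t x)"
    by (rule locally_lipschitz_on_compact[OF f_lip]) (auto simp: B_def)
  then have "L-lipschitz_on B (augmented f)" by (rule augmented_lipschitz)
  from gronwall_solutions[OF this solution_upto_augmented[OF \<phi>] solution_upto_augmented[OF \<psi>]]
  have "dist (t, \<phi> t) (t, \<psi> t) \<le> exp (L * t) * dist (0::real, \<phi> 0) (0, \<psi> 0)"
    using t by (auto simp: B_def)
  then show ?thesis using \<phi> \<psi> by (simp add: solution_upto_def)
qed

lemma traj_eq:
  assumes "solution_upto f x0 t \<phi>" "t \<in> {0..T}"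
  shows "traj f x0 t = \<phi> t"
  unfolding traj_def using assms solution_upto_unique by blast

text \<open>\<open>admissible\<close> asks for a solution on \<open>[0,s]\<close> separately for
  each \<open>s\<close>. Uniqueness identifies all of them with restrictions of a single curve, here
  and in the converse below.\<close>

lemma admissibleI:
  assumes \<phi>: "solution_upto f x0 t \<phi>" and t: "t \<in> {0..T}" "x0 \<in> X0"
    and X: "\<And>s. s \<in> {0..t} \<Longrightarrow> \<phi> s \<in> X"
  shows "(t, x0) \<in> admissible T X X0 f"
  unfolding admissible_def traj_in_def traj_exists_def
proof (clarsimp simp: t(2), intro conjI)
  show "0 \<le> t" "t \<le> T" using t by auto
  show "\<forall>s\<in>{0..t}. Ex (solution_upto f x0 s) \<and> traj f x0 s \<in> X"
  proof
    fix s assume s: "s \<in> {0..t}"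
    then have "solution_upto f x0 s \<phi>" using solution_upto_subset[OF \<phi>] by simp
    then show "Ex (solution_upto f x0 s) \<and> traj f x0 s \<in> X"
      using traj_eq[of x0 s \<phi>] X[OF s] s t by auto
  qed
qed

lemma admissibleE:
  assumes "(t, x0) \<in> admissible T X X0 f"
  obtains \<phi> where "solution_upto f x0 t \<phi>" "t \<in> {0..T}" "x0 \<in> X0"
    "traj f x0 t = \<phi> t" "\<And>s. s \<in> {0..t} \<Longrightarrow> \<phi> s \<in> X"
proof -
  from assms have t: "t \<in> {0..T}" "x0 \<in> X0" and *: "\<And>s. s \<in> {0..t} \<Longrightarrow> traj_in f x0 s X"
    by (auto simp: admissible_def)
  then obtain \<phi> where \<phi>: "solution_upto f x0 t \<phi>"
    using *[of t] by (auto simp: traj_in_def traj_exists_def)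
  have "\<phi> s \<in> X" if "s \<in> {0..t}" for s
    using *[OF that] traj_eq[OF solution_upto_subset[OF \<phi>, of s]] that t
    by (auto simp: traj_in_def)
  with that \<phi> t traj_eq[OF \<phi> t(1)] show thesis by blast
qed

end

text \<open>Joint differentiability makes the time derivative and the gradient term add up to the
  total derivative in the direction \<open>(1, f t x)\<close>.\<close>

lemma lie_derivative_eq:
  fixes v :: "real \<times> (real^'n) \<Rightarrow> real"
  assumes "(v has_derivative v') (at (t, x))"
  shows "lie_derivative f v (t, x) = v' (1, f t x)"
proof -
  interpret v': bounded_linear v' using assms by (rule has_derivative_bounded_linear)
  have "((\<lambda>s. (s, x)) has_derivative (\<lambda>h. (h, 0))) (at t)"
    by (auto intro!: derivative_eq_intros)
  from has_derivative_compose[OF this assms]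
  have "((\<lambda>s. v (s, x)) has_derivative (\<lambda>h. v' (h, 0))) (at t)" .
  moreover have "(\<lambda>h. v' (h, 0)) = (*) (v' (1, 0))"
  proof
    fix h
    have "v' (h, 0) = v' (h *\<^sub>R (1, 0))" by simp
    also have "\<dots> = v' (1, 0) * h" by (simp only: v'.scaleR real_scaleR_def mult.commute)
    finally show "v' (h, 0) = v' (1, 0) * h" .
  qed
  ultimately have "((\<lambda>s. v (s, x)) has_real_derivative v' (1, 0)) (at t)"
    by (simp only: has_field_derivative_def)
  then have 1: "deriv (\<lambda>s. v (s, x)) t = v' (1, 0)" by (rule DERIV_imp_deriv)
  \<comment> \<open>The Riesz vector of the state part of \<open>v'\<close>, the candidate for the
    gradient.\<close>
  define D where "D = (\<Sum>b\<in>Basis. v' (0, b) *\<^sub>R b)"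
  have "((\<lambda>z. (t, z)) has_derivative (\<lambda>h. (0, h))) (at x)"
    by (auto intro!: derivative_eq_intros)
  from has_derivative_compose[OF this assms]
  have 2: "((\<lambda>z. v (t, z)) has_derivative (\<lambda>h. v' (0, h))) (at x)" .
  have 3: "v' (0, h) = h \<bullet> D" for h
  proof -
    interpret w: bounded_linear "\<lambda>h. v' (0, h)" using 2 by (rule has_derivative_bounded_linear)
    have "v' (0, h) = v' (0, \<Sum>b\<in>Basis. (h \<bullet> b) *\<^sub>R b)" by (simp add: euclidean_representation)
    also have "\<dots> = h \<bullet> D" by (simp add: D_def w.sum w.scaleR inner_sum_right mult.commute)
    finally show ?thesis .
  qed
  have D: "GDERIV (\<lambda>z. v (t, z)) x :> D"
    unfolding gderiv_def using 2 by (simp add: 3)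
  have "gradient (\<lambda>z. v (t, z)) x = D"
    unfolding gradient_def
  proof (rule the_equality)
    show "GDERIV (\<lambda>z. v (t, z)) x :> D" by (rule D)
    fix E assume "GDERIV (\<lambda>z. v (t, z)) x :> E"
    then have "(\<lambda>h. h \<bullet> E) = (\<lambda>h. h \<bullet> D)"
      using D unfolding gderiv_def by (rule has_derivative_unique)
    then have "(E - D) \<bullet> E = (E - D) \<bullet> D" by metis
    then have "(E - D) \<bullet> (E - D) = 0" unfolding inner_diff_right by simp
    then show "E = D" by simp
  qed
  then have "lie_derivative f v (t, x) = v' (1, 0) + v' (0, f t x)"
    by (simp add: lie_derivative_def 1 3)
  also have "\<dots> = v' (1, f t x)" by (simp add: v'.add[symmetric])
  finally show ?thesis .
qed

text \<open>Along the curve \<open>(s, \<phi> s)\<close> the derivative of \<open>v\<close> is its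
  Lie derivative, and admissibility keeps the curve in \<open>X\<close>, where this is nonnegative.
  The remaining constraints are chained at the two endpoints.\<close>

lemma weak_duality:
  fixes f :: "real \<Rightarrow> real^'n \<Rightarrow> real^'n"
  assumes f_lip: "locally_lipschitz_on ({0..T} \<times> UNIV) (\<lambda>(t, x). f t x)"
    and feas: "dual_feasible T X X0 Xu f c \<gamma> v w"
    and adm: "(t, x0) \<in> admissible T X X0 f" and y: "y \<in> Xu"
  shows "\<gamma> \<le> c (traj f x0 t) y"
proof -
  obtain \<phi> where \<phi>: "solution_upto f x0 t \<phi>" and t: "t \<in> {0..T}" "x0 \<in> X0"
    and traj: "traj f x0 t = \<phi> t" and X: "\<And>s. s \<in> {0..t} \<Longrightarrow> \<phi> s \<in> X"
    using admissibleE[OF f_lip adm] by blast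
  obtain U and v' :: "real \<times> (real^'n) \<Rightarrow> ((real \<times> (real^'n)) \<Rightarrow>\<^sub>L real)"
    where U: "{0..T} \<times> X \<subseteq> U" and v': "\<And>p. p \<in> U \<Longrightarrow> (v has_derivative blinfun_apply (v' p)) (at p)"
    using feas unfolding dual_feasible_def C1_near_def by blast
  have aug: "solves_upto (augmented f) t (\<lambda>s. (s, \<phi> s))" by (rule solution_upto_augmented[OF \<phi>])
  have v'_at: "(v has_derivative blinfun_apply (v' (s, \<phi> s))) (at (s, \<phi> s))" if "s \<in> {0..t}" for s
    by (rule v') (use U X[OF that] that t in auto)
  have "v (0, \<phi> 0) \<le> v (t, \<phi> t)"
  proof (rule DERIV_nonneg_imp_increasing_open[where f = "\<lambda>s. v (s, \<phi> s)"])
    fix s assume s: "0 < s" "s < t"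
    have "((\<lambda>s. (s, \<phi> s)) has_vector_derivative (1, f s (\<phi> s))) (at s)"
      using solves_upto_at[OF aug s] by (simp add: augmented_def)
    from vector_derivative_diff_chain_within[OF this has_derivative_at_withinI[OF v'_at]] s
    have "((\<lambda>s. v (s, \<phi> s)) has_real_derivative blinfun_apply (v' (s, \<phi> s)) (1, f s (\<phi> s))) (at s)"
      by (simp add: o_def has_real_derivative_iff_has_vector_derivative)
    moreover have "0 \<le> blinfun_apply (v' (s, \<phi> s)) (1, f s (\<phi> s))"
    proof -
      have "lie_derivative f v (s, \<phi> s) \<ge> 0"
        using feas X[of s] s t unfolding dual_feasible_def by auto
      then show ?thesis using lie_derivative_eq[OF v'_at] s by simp
    qed
    ultimately show "\<exists>y. ((\<lambda>s. v (s, \<phi> s)) has_real_derivative y) (at s) \<and> 0 \<le> y" by blast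
  next
    have "continuous_on ((\<lambda>s. (s, \<phi> s)) ` {0..t}) v"
      using has_derivative_continuous[OF v'_at] by (auto intro!: continuous_at_imp_continuous_on)
    then show "continuous_on {0..t} (\<lambda>s. v (s, \<phi> s))"
      by (rule continuous_on_compose2[OF _ solves_upto_continuous[OF aug]]) simp
  qed (use t in auto)
  moreover have "\<gamma> \<le> v (0, \<phi> 0)"
    using feas \<phi> t by (simp add: dual_feasible_def solution_upto_def)
  moreover have "v (t, \<phi> t) \<le> w (\<phi> t)" "w (\<phi> t) \<le> c (\<phi> t) y"
    using feas X[of t] t y by (auto simp: dual_feasible_def)
  ultimately show ?thesis unfolding traj by linarith
qed

text \<open>A quantity charged at rate \<open>n\<close> against a fixed budget must vanish. This is
  applied to the penalty and to the distance term of the Lipschitz cost.\<close>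

lemma tendsto_0_of_nat_mult_bound:
  fixes q :: "nat \<Rightarrow> real"
  assumes "\<And>n. 0 \<le> q n" "\<And>n. real n * q n \<le> D"
  shows "q \<longlonglongrightarrow> 0"
proof (rule tendsto_sandwich[OF _ _ tendsto_const])
  show "(\<lambda>n. D / real n) \<longlonglongrightarrow> 0" by (rule lim_const_over_n)
  show "\<forall>\<^sub>F n in sequentially. q n \<le> D / real n"
    using eventually_gt_at_top[of 0]
    by eventually_elim (use assms(2) in \<open>simp add: field_simps\<close>)
qed (use assms in auto)

subsection \<open>Strong duality\<close>

text \<open>
  The largest \<open>k\<close>-Lipschitz minorant of \<open>x \<mapsto> min\<^sub>y c(x,y)\<close> on \<open>X\<close>, extended to the whole space; the cap
  \<open>u\<close> bounds its oscillation, so that a penalty can dominate it.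
\<close>

definition lipschitz_cost ::
    "'a set \<Rightarrow> 'b set \<Rightarrow> ('a::metric_space \<Rightarrow> 'b \<Rightarrow> real) \<Rightarrow> real \<Rightarrow> nat \<Rightarrow> 'a \<Rightarrow> real" where
  "lipschitz_cost X Y c u k x =
     min u (INF (z, y)\<in>X \<times> Y. c z y + real k * dist z x)"

context
  fixes X :: "'a::metric_space set" and Y :: "'b set" and c :: "'a \<Rightarrow> 'b \<Rightarrow> real" and l u :: real
  assumes ne: "X \<noteq> {}" "Y \<noteq> {}"
    and l: "\<forall>x\<in>X. \<forall>y\<in>Y. l \<le> c x y" and "l \<le> u"
begin

lemma lipschitz_cost_bdd: "bdd_below ((\<lambda>(z, y). c z y + real k * dist z x) ` (X \<times> Y))"
  by (rule bdd_belowI[of _ l]) (use l in \<open>auto intro!: add_increasing2\<close>)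

lemma lipschitz_cost_ge: "l \<le> lipschitz_cost X Y c u k x"
  unfolding lipschitz_cost_def using ne l \<open>l \<le> u\<close>
  by (auto intro!: cINF_greatest add_increasing2)

lemma lipschitz_cost_le_cost:
  assumes "x \<in> X" "y \<in> Y"
  shows "lipschitz_cost X Y c u k x \<le> c x y"
  using cINF_lower[OF lipschitz_cost_bdd, of "(x, y)" k x] assms
  by (auto simp: lipschitz_cost_def)

lemma lipschitz_cost_less:
  assumes "lipschitz_cost X Y c u k x < b" "b \<le> u"
  obtains z y where "z \<in> X" "y \<in> Y" "c z y + real k * dist z x < b"
proof -
  have "(INF (z, y)\<in>X \<times> Y. c z y + real k * dist z x) < b"
    using assms by (auto simp: lipschitz_cost_def)
  from cInf_lessD[OF _ this] ne that show thesis by auto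
qed

lemma lipschitz_cost_lipschitz: "(real k)-lipschitz_on S (lipschitz_cost X Y c u k)"
proof -
  have "(real k)-lipschitz_on S (\<lambda>x. INF zy\<in>X \<times> Y. (\<lambda>(z, y) x. c z y + real k * dist z x) zy x)"
  proof (rule lipschitz_on_INF)
    fix zy assume "zy \<in> X \<times> Y"
    show "(real k)-lipschitz_on S ((\<lambda>(z, y) x. c z y + real k * dist z x) zy)"
    proof (rule lipschitz_onI)
      fix a b :: 'a
      have "\<bar>dist (fst zy) a - dist (fst zy) b\<bar> \<le> dist a b"
        by (metis abs_dist_diff_le dist_commute)
      then have "real k * \<bar>dist (fst zy) a - dist (fst zy) b\<bar> \<le> real k * dist a b"
        by (rule mult_left_mono) simp
      then show "dist ((\<lambda>(z, y) x. c z y + real k * dist z x) zy a)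
          ((\<lambda>(z, y) x. c z y + real k * dist z x) zy b) \<le> real k * dist a b"
        by (simp add: split_beta dist_real_def right_diff_distrib[symmetric] abs_mult)
    qed simp
  next
    show "bdd_below ((\<lambda>zy. (\<lambda>(z, y) x. c z y + real k * dist z x) zy x) ` (X \<times> Y))" for x
      using lipschitz_cost_bdd[of k x] by (simp add: case_prod_unfold)
  qed (use ne in auto)
  then have *: "(real k)-lipschitz_on S (\<lambda>x. INF (z, y)\<in>X \<times> Y. c z y + real k * dist z x)"
    by (simp add: case_prod_unfold)
  show ?thesis
  proof (rule lipschitz_onI)
    fix a b assume "a \<in> S" "b \<in> S"
    from lipschitz_onD[OF * this]
    show "dist (lipschitz_cost X Y c u k a) (lipschitz_cost X Y c u k b) \<le> real k * dist a b"
      unfolding lipschitz_cost_def dist_real_def by linarith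
  qed simp
qed

end

text \<open>Here \<open>P\<close> is any real lower bound for the costs. One half of
  \<open>e\<close> is spent on penalising the state constraint and on the Lipschitz minorant of the
  cost, the other half on smoothing and on repairing the sign of the Lie derivative.\<close>

lemma near_optimal_dual:
  fixes f :: "real \<Rightarrow> real^'n \<Rightarrow> real^'n"
  assumes T: "0 \<le> T" and X: "compact X" and Xu: "compact Xu" "Xu \<noteq> {}"
    and X0: "compact X0" "X0 \<subseteq> X" "X0 \<noteq> {}"
    and f_lip: "locally_lipschitz_on ({0..T} \<times> UNIV) (\<lambda>(t, x). f t x)"
    and c: "continuous_on (X \<times> Xu) (\<lambda>(x, y). c x y)"
    and P: "\<And>t x0 y. (t, x0) \<in> admissible T X X0 f \<Longrightarrow> y \<in> Xu \<Longrightarrow> P \<le> c (traj f x0 t) y"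
    and e: "0 < e"
  shows "\<exists>v w. dual_feasible T X X0 Xu f c (P - e) v w"
proof -

  \<comment> \<open>Cut-off to a bounded Lipschitz field\<close>
  define Q where "Q = {0..T} \<times> X"
  have "X \<noteq> {}" using X0 by auto
  then have Q: "compact Q" "closed Q" "Q \<noteq> {}"
    using X T by (auto simp: Q_def compact_Times compact_imp_closed)
  obtain R where R: "X \<subseteq> cball 0 R"
    using compact_imp_bounded[OF X] by (auto simp: bounded_iff subset_eq)
  \<comment> \<open>\<open>X\<close> may fail to be convex, so the cut-off projects onto a compact
    convex set containing \<open>Q\<close>.\<close>
  define B where "B = {0..T} \<times> cball (0 :: real^'n) R"
  have B: "compact B" "closed B" "convex B" "Q \<subseteq> B" "B \<noteq> {}" "B \<subseteq> {0..T} \<times> UNIV"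
    using R T \<open>X \<noteq> {}\<close> by (auto simp: B_def Q_def compact_Times closed_Times convex_Times)
  obtain L where "L-lipschitz_on B (\<lambda>(t, x). f t x)"
    by (rule locally_lipschitz_on_compact[OF f_lip B(1,6)])
  then have L: "L-lipschitz_on B (augmented f)" by (rule augmented_lipschitz)
  have "bounded (augmented f ` B)"
    by (intro compact_imp_bounded compact_continuous_image lipschitz_on_continuous_on[OF L] B)
  then obtain M where M: "\<And>p. p \<in> B \<Longrightarrow> norm (augmented f p) \<le> M"
    by (auto simp: bounded_iff)
  \<comment> \<open>Projection onto the convex set \<open>B\<close> is 1-Lipschitz and fixes
    \<open>Q\<close>, so \<open>F\<close> is globally Lipschitz and bounded and agrees with the
    augmented field on \<open>Q\<close>.\<close>
  define F where "F = (\<lambda>p. augmented f (closest_point B p))"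
  have F_Q: "F (t, x) = (1, f t x)" if "t \<in> {0..T}" "x \<in> X" for t x
  proof -
    have "(t, x) \<in> B" using that B(4) by (auto simp: Q_def)
    then show ?thesis by (simp add: F_def augmented_def closest_point_self)
  qed
  \<comment> \<open>Off \<open>B\<close> the argument of \<open>f\<close> is projected, but the
    clock still runs at unit speed, so that no curve stays near \<open>Q\<close> forever.\<close>
  have fst_F: "fst (F p) = 1" for p by (simp add: F_def augmented_def split_beta)
  interpret bounded_lipschitz_field F L M
  proof
    have "1-lipschitz_on UNIV (closest_point B)"
      by (rule lipschitz_onI) (use closest_point_lipschitz[OF B(3,2,5)] in auto)
    moreover have "closest_point B ` UNIV \<subseteq> B"
      using closest_point_in_set[OF B(2,5)] by auto
    ultimately have "(L * 1)-lipschitz_on UNIV F"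
      unfolding F_def by (intro lipschitz_on_compose2 lipschitz_on_subset[OF L])
    then show "L-lipschitz_on UNIV F" by simp
    show "norm (F p) \<le> M" for p
      unfolding F_def by (rule M[OF closest_point_in_set[OF B(2,5)]])
  qed
  have fst_flow: "fst (flow p t) = fst p + t" if "0 \<le> t" for p t
  proof -
    have "((\<lambda>s. fst (F (flow p s))) has_integral fst (flow p t - p)) {0..t}"
      using has_integral_linear[OF flow_integral[OF that] bounded_linear_fst] by (simp add: o_def)
    moreover have "((\<lambda>s. fst (F (flow p s))) has_integral t) {0..t}"
      using has_integral_const_real[of "1::real" 0 t] that by (simp add: fst_F)
    ultimately have "fst (flow p t - p) = t" by (rule has_integral_unique)
    then show ?thesis by simp
  qed

  \<comment> \<open>A horizon by which every curve has paid a unit penalty\<close>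
  define S where "S = T + 4"
  have S: "0 \<le> S" "0 \<le> T + 3" "S = (T + 3) + 1" using T by (auto simp: S_def)
  have infdist_Q: "1 \<le> infdist p Q" if "fst p \<le> -1 \<or> T + 1 \<le> fst p" for p
  proof -
    have "1 \<le> dist p q" if "q \<in> Q" for q
    proof -
      have "1 \<le> dist (fst p) (fst q)"
        using that \<open>fst p \<le> -1 \<or> T + 1 \<le> fst p\<close> by (auto simp: Q_def dist_real_def)
      also have "\<dots> \<le> dist p q" by (rule dist_fst_le)
      finally show ?thesis .
    qed
    then show ?thesis unfolding infdist_notempty[OF Q(3)] by (intro cINF_greatest Q)
  qed
  \<comment> \<open>A clock starting at or below -2 stays at or below -1 for one unit of time. Any
    other clock is past \<open>T + 1\<close> after time \<open>T + 3\<close>, and one further unit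
    of time makes up the horizon \<open>T + 4\<close>.\<close>
  have exit: "1 \<le> penalty Q p S" for p
  proof (cases "fst p \<le> - 2")
    case True
    then have "1 \<le> penalty Q p 1" by (intro penalty_unit_ge infdist_Q) (auto simp: fst_flow)
    also have "\<dots> \<le> penalty Q p S" using T by (intro penalty_mono) (auto simp: S_def)
    finally show ?thesis .
  next
    case False
    then have "1 \<le> penalty Q (flow p (T + 3)) 1"
      using S by (intro penalty_unit_ge infdist_Q) (auto simp: fst_flow)
    then show ?thesis
      using penalty_add[of "T + 3" 1 Q p] penalty_nonneg[of Q p "T + 3"] S by simp
  qed

  \<comment> \<open>Lipschitz terminal costs and penalty weights\<close>
  have "bounded ((\<lambda>(x, y). c x y) ` (X \<times> Xu))"
    by (intro compact_imp_bounded compact_continuous_image c compact_Times X Xu)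
  then obtain u where u: "\<And>x y. x \<in> X \<Longrightarrow> y \<in> Xu \<Longrightarrow> \<bar>c x y\<bar> \<le> u"
    unfolding bounded_iff by fastforce
  then have l: "\<forall>x\<in>X. \<forall>y\<in>Xu. - u \<le> c x y" by (smt (verit))
  have "0 \<le> u" using u \<open>X \<noteq> {}\<close> Xu(2) by (meson abs_ge_zero all_not_in_conv order_trans)
  then have lu: "- u \<le> u" by simp
  note cost = \<open>X \<noteq> {}\<close> Xu(2) l lu
  define w where "w = lipschitz_cost X Xu c u"
  define W where "W = (\<lambda>k (p :: real \<times> (real^'n)). w k (snd p))"
  \<comment> \<open>The summand \<open>2 * u\<close> dominates the oscillation of
    \<open>W k\<close>, whose values lie between \<open>- u\<close> and \<open>u\<close>; the
    summand \<open>k\<close> drives the penalty to 0 in the limit.\<close>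
  define K where "K = (\<lambda>k. real k + 2 * u)"
  have w_bounds: "- u \<le> w k x" "w k x \<le> u" for k x
    using lipschitz_cost_ge[OF cost] by (auto simp: w_def lipschitz_cost_def)
  then have W_bounds: "- u \<le> W k p" "W k p \<le> u" for k p by (auto simp: W_def)
  have K: "0 \<le> K k" "u - - u \<le> K k" for k using \<open>0 \<le> u\<close> by (auto simp: K_def)
  have W_lip: "(real k)-lipschitz_on UNIV (W k)" for k
  proof -
    have "1-lipschitz_on UNIV (snd :: real \<times> (real^'n) \<Rightarrow> _)"
      by (rule lipschitz_onI) (auto simp: dist_snd_le)
    then have "(real k * 1)-lipschitz_on UNIV (W k)"
      unfolding W_def w_def
      by (rule lipschitz_on_compose2) (rule lipschitz_cost_lipschitz[OF cost])
    then show ?thesis by simp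
  qed
  let ?V = "\<lambda>k. penalised_value Q (W k) (K k) S"

  \<comment> \<open>On the degenerate interval \<open>[0,0]\<close> the filter is trivial, so the
    derivative condition is vacuous and the constant curve is a solution.\<close>
  have adm0: "(0, x0) \<in> admissible T X X0 f" "traj f x0 0 = x0" if "x0 \<in> X0" for x0
  proof -
    have "at 0 within {0::real} = bot" by (simp add: at_within_eq_bot_iff)
    then have "solution_upto f x0 0 (\<lambda>_. x0)"
      by (simp add: solution_upto_def has_vector_derivative_def has_derivative_def bounded_linear_scaleR_left)
    then show "(0, x0) \<in> admissible T X X0 f" "traj f x0 0 = x0"
      using that X0 T by (auto intro!: admissibleI[OF f_lip] simp: traj_eq[OF f_lip])
  qed
  \<comment> \<open>Consequently a value of \<open>w k\<close> below \<open>P - e / 2\<close> lies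
    below the cap \<open>u\<close> and must come from the infimum in the Lipschitz cost.\<close>
  have P_le: "P \<le> u"
  proof -
    obtain x0 y where xy: "x0 \<in> X0" "y \<in> Xu" using X0 Xu by auto
    have "P \<le> c x0 y" using P[OF adm0(1)[OF xy(1)] xy(2)] adm0(2)[OF xy(1)] by simp
    also have "\<dots> \<le> u" using u[of x0 y] xy X0 by auto
    finally show ?thesis .
  qed

  \<comment> \<open>Compactness as the penalty grows\<close>
  have "\<exists>k. \<forall>x0\<in>X0. P - e / 2 \<le> ?V k (0, x0)"
  proof (rule ccontr)
    assume "\<not> ?thesis"
    then have neg: "\<And>k. \<exists>x0\<in>X0. ?V k (0, x0) < P - e / 2" by (auto simp: not_le)
    \<comment> \<open>For each \<open>k\<close>: a bad starting point, a stopping time that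
      witnesses it, and a pair \<open>z\<close>, \<open>y\<close> witnessing the infimum in the
      Lipschitz cost at the endpoint.\<close>
    have "\<exists>x s z y. x \<in> X0 \<and> s \<in> {0..S} \<and> z \<in> X \<and> y \<in> Xu \<and>
        W k (flow (0, x) s) + K k * penalty Q (0, x) s < P - e / 2 \<and>
        c z y + real k * dist z (snd (flow (0, x) s)) < P - e / 2" for k
    proof -
      obtain x where x: "x \<in> X0" "?V k (0, x) < P - e / 2" using neg by blast
      have "\<exists>s\<in>{0..S}. W k (flow (0, x) s) + K k * penalty Q (0, x) s < P - e / 2"
        using cInf_lessD[OF _ x(2)[unfolded penalised_value_def]] S(1) by auto
      then obtain s where s: "s \<in> {0..S}"
        "W k (flow (0, x) s) + K k * penalty Q (0, x) s < P - e / 2"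
        by blast
      have "w k (snd (flow (0, x) s)) < P - e / 2"
        using s(2) mult_nonneg_nonneg[OF K(1) penalty_nonneg, of k Q "(0, x)" s] by (simp add: W_def)
      then obtain z y where "z \<in> X" "y \<in> Xu" "c z y + real k * dist z (snd (flow (0, x) s)) < P - e / 2"
        unfolding w_def by (rule lipschitz_cost_less[OF cost]) (use P_le e in auto)
      with x s show ?thesis by blast
    qed
    then obtain x s z y where seq: "\<And>k. x k \<in> X0" "\<And>k. s k \<in> {0..S}" "\<And>k. z k \<in> X" "\<And>k. y k \<in> Xu"
      and low: "\<And>k. W k (flow (0, x k) (s k)) + K k * penalty Q (0, x k) (s k) < P - e / 2"
        "\<And>k. c (z k) (y k) + real k * dist (z k) (snd (flow (0, x k) (s k))) < P - e / 2"
      by metis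
    have "compact (X0 \<times> {0..S} \<times> X \<times> Xu)"
      by (intro compact_Times X0 X Xu compact_Icc)
    moreover have "\<forall>k. (x k, s k, z k, y k) \<in> X0 \<times> {0..S} \<times> X \<times> Xu" using seq by auto
    ultimately obtain a r where a: "a \<in> X0 \<times> {0..S} \<times> X \<times> Xu" and r: "strict_mono r"
      and lim: "((\<lambda>k. (x k, s k, z k, y k)) \<circ> r) \<longlonglongrightarrow> a"
      unfolding compact_def by meson
    obtain x' s' z' y' where a_eq: "a = (x', s', z', y')" by (cases a) auto
    from a have x': "x' \<in> X0" and s': "s' \<in> {0..S}" and z': "z' \<in> X" and y': "y' \<in> Xu"
      by (auto simp: a_eq)
    have x_lim: "(\<lambda>k. x (r k)) \<longlonglongrightarrow> x'" and s_lim: "(\<lambda>k. s (r k)) \<longlonglongrightarrow> s'"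
      and z_lim: "(\<lambda>k. z (r k)) \<longlonglongrightarrow> z'" and y_lim: "(\<lambda>k. y (r k)) \<longlonglongrightarrow> y'"
      using tendsto_fst[OF lim] tendsto_fst[OF tendsto_snd[OF lim]]
        tendsto_fst[OF tendsto_snd[OF tendsto_snd[OF lim]]]
        tendsto_snd[OF tendsto_snd[OF tendsto_snd[OF lim]]]
      by (auto simp: a_eq o_def)
    \<comment> \<open>All costs are at least \<open>- u\<close>, so \<open>k\<close> times the
      penalty stays below \<open>P + u\<close>. The same budget makes \<open>z k\<close> and the
      endpoint of the curve merge in the limit.\<close>
    have "(\<lambda>k. penalty Q (0, x k) (s k)) \<longlonglongrightarrow> 0"
    proof (rule tendsto_0_of_nat_mult_bound[OF penalty_nonneg])
      fix k
      have "real k * penalty Q (0, x k) (s k) \<le> K k * penalty Q (0, x k) (s k)"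
        using \<open>0 \<le> u\<close> by (intro mult_right_mono penalty_nonneg) (simp add: K_def)
      then show "real k * penalty Q (0, x k) (s k) \<le> P + u"
        using low(1)[of k] W_bounds(1)[of k "flow (0, x k) (s k)"] e by linarith
    qed
    from LIMSEQ_subseq_LIMSEQ[OF this r]
    have pen: "(\<lambda>k. penalty Q (0, x (r k)) (s (r k))) \<longlonglongrightarrow> 0" by (simp add: o_def)
    have "(\<lambda>k. dist (z k) (snd (flow (0, x k) (s k)))) \<longlonglongrightarrow> 0"
    proof (rule tendsto_0_of_nat_mult_bound)
      fix k
      show "real k * dist (z k) (snd (flow (0, x k) (s k))) \<le> P + u"
        using low(2)[of k] l[rule_format, OF seq(3,4), of k k] e by linarith
    qed simp
    from LIMSEQ_subseq_LIMSEQ[OF this r]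
    have dist_lim: "(\<lambda>k. dist (z (r k)) (snd (flow (0, x (r k)) (s (r k))))) \<longlonglongrightarrow> 0" by (simp add: o_def)
    have p_lim: "(\<lambda>k. (0::real, x (r k))) \<longlonglongrightarrow> (0, x')" by (intro tendsto_intros x_lim)
    define \<phi> where "\<phi> = (\<lambda>t. snd (flow (0, x') t))"
    have "(\<lambda>k. snd (flow (0, x (r k)) (s (r k)))) \<longlonglongrightarrow> \<phi> s'"
      unfolding \<phi>_def using seq(2) s'
      by (intro tendsto_snd flow_tendsto[OF p_lim s_lim]) auto
    from LIMSEQ_unique[OF tendsto_dist[OF z_lim this] dist_lim]
    have z'_eq: "z' = \<phi> s'" by simp
    \<comment> \<open>Membership in \<open>Q\<close> concerns both coordinates: the state stays in
      \<open>X\<close>, and the clock stays in \<open>[0,T]\<close>, so that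
      \<open>s' \<le> T\<close> although the horizon \<open>S\<close> is longer. On \<open>Q\<close>
      the cut-off field is the original one, so the limit is a genuine trajectory.\<close>
    have flow_Q: "flow (0, x') t \<in> Q" if "t \<in> {0..s'}" for t
    proof (rule flow_in_of_penalty_tendsto_0[OF p_lim s_lim _ _ pen Q(2,3)])
      show "(0, x') \<in> Q" using x' X0 T by (auto simp: Q_def)
    qed (use seq(2) s' that in auto)
    have flow_eq: "flow (0, x') t = (t, \<phi> t)" if "0 \<le> t" for t
      using fst_flow[OF that, of "(0, x')"] by (simp add: \<phi>_def prod_eq_iff)
    have \<phi>_X: "t \<in> {0..T}" "\<phi> t \<in> X" if "t \<in> {0..s'}" for t
      using flow_Q[OF that] flow_eq[of t] that by (auto simp: Q_def)
    have "solution_upto f x' s' \<phi>"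
      unfolding solution_upto_def
    proof (intro conjI ballI)
      show "\<phi> 0 = x'" by (simp add: \<phi>_def)
      fix t assume t: "t \<in> {0..s'}"
      have "(flow (0, x') has_vector_derivative F (flow (0, x') t)) (at t within {0..s'})"
        using flow_solves[of s' "(0, x')"] t by (simp add: solves_upto_def)
      then have "(\<phi> has_vector_derivative snd (F (flow (0, x') t))) (at t within {0..s'})"
        unfolding \<phi>_def by (rule bounded_linear.has_vector_derivative[OF bounded_linear_snd])
      then show "(\<phi> has_vector_derivative f t (\<phi> t)) (at t within {0..s'})"
        using flow_eq[of t] F_Q[OF \<phi>_X[OF t]] t by simp
    qed
    moreover have "s' \<in> {0..T}" using \<phi>_X(1)[of s'] s' by simp
    ultimately have "P \<le> c z' y'"
      using P[OF admissibleI[OF f_lip, of x' s' \<phi> X0 X] y'] traj_eq[OF f_lip, of x' s' \<phi>] x' \<phi>_X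
      by (simp add: z'_eq)
    \<comment> \<open>Dropping the nonnegative distance term leaves a bound that survives the limit
      and contradicts \<open>P \<le> c z' y'\<close>.\<close>
    moreover have "c z' y' \<le> P - e / 2"
    proof (rule LIMSEQ_le_const2)
      show "(\<lambda>k. c (z (r k)) (y (r k))) \<longlonglongrightarrow> c z' y'"
        using continuous_on_tendsto_compose[OF c tendsto_Pair[OF z_lim y_lim]] z' y' seq by simp
      have "c (z (r k)) (y (r k)) \<le> P - e / 2" for k
        using low(2)[of "r k"] mult_nonneg_nonneg[OF of_nat_0_le_iff zero_le_dist,
            of "r k" "z (r k)" "snd (flow (0, x (r k)) (s (r k)))"]
        by linarith
      then show "\<exists>N. \<forall>k\<ge>N. c (z (r k)) (y (r k)) \<le> P - e / 2" by blast
    qed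
    ultimately show False using e by simp
  qed
  then obtain k where k: "\<And>x0. x0 \<in> X0 \<Longrightarrow> P - e / 2 \<le> ?V k (0, x0)" by blast

  \<comment> \<open>Smoothing and correction of the Lie derivative\<close>
  define d where "d = e / (2 * (T + 2))"
  have d: "0 < d" "d * (T + 2) = e / 2" using e T by (auto simp: d_def field_simps)
  obtain v v' where v: "\<And>p. (v has_derivative blinfun_apply (v' p)) (at p)"
    and v'_cont: "continuous_on UNIV v'" and close: "\<And>p. \<bar>v p - ?V k p\<bar> \<le> d"
    and sub: "\<And>p. p \<in> Q \<Longrightarrow> - d \<le> blinfun_apply (v' p) (F p)"
    by (rule smooth_subsolution[OF W_lip W_bounds K S(1) exit d(1)]) blast
  \<comment> \<open>The term \<open>d * fst p\<close> raises the Lie derivative from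
    \<open>\<ge> - d\<close> to \<open>\<ge> 0\<close>. Subtracting \<open>d * T\<close> keeps the
    correction nonpositive on \<open>[0,T]\<close>, and \<open>- d\<close> absorbs the smoothing
    error, so that \<open>g\<close> stays below the value function. The total loss at time 0 is at
    most \<open>d * (T + 2) = e / 2\<close>.\<close>
  define g where "g = (\<lambda>p. v p - d + d * (fst p - T))"
  define g' where "g' = (\<lambda>p. v' p + d *\<^sub>R fst_blinfun)"
  have g': "(g has_derivative blinfun_apply (g' p)) (at p)" for p
  proof -
    have "(g has_derivative (\<lambda>h. blinfun_apply (v' p) h + d * fst h)) (at p)"
      unfolding g_def by (auto intro!: derivative_eq_intros v)
    also have "(\<lambda>h. blinfun_apply (v' p) h + d * fst h) = blinfun_apply (g' p)"
      by (simp add: g'_def fun_eq_iff blinfun.add_left blinfun.scaleR_left)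
    finally show ?thesis .
  qed
  have "dual_feasible T X X0 Xu f c (P - e) g (w k)"
    unfolding dual_feasible_def
  proof (intro conjI ballI)
    fix x assume "x \<in> X0"
    from k[OF this] close[of "(0, x)"] d(2) show "P - e \<le> g (0, x)"
      unfolding g_def by (simp add: algebra_simps abs_le_iff)
  next
    fix x y assume "x \<in> X" "y \<in> Xu"
    then show "w k x \<le> c x y" unfolding w_def by (rule lipschitz_cost_le_cost[OF cost])
  next
    fix t x assume t: "t \<in> {0..T}" "x \<in> X"
    have "d * (t - T) \<le> 0" using d t by (simp add: mult_nonneg_nonpos)
    then have "g (t, x) \<le> ?V k (t, x)" using close[of "(t, x)"] by (simp add: g_def abs_le_iff)
    also have "\<dots> \<le> W k (t, x)" by (rule penalised_value_le_self[OF W_bounds(1) K(1) S(1)])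
    finally show "g (t, x) \<le> w k x" by (simp add: W_def)
    show "0 \<le> lie_derivative f g (t, x)"
      using sub[of "(t, x)"] t
      by (simp add: lie_derivative_eq[OF g'] F_Q Q_def g'_def blinfun.add_left blinfun.scaleR_left)
  next
    show "continuous_on X (w k)"
      unfolding w_def by (rule lipschitz_on_continuous_on[OF lipschitz_cost_lipschitz[OF cost]])
    show "C1_near ({0..T} \<times> X) g"
      unfolding C1_near_def
      by (rule exI[of _ UNIV], rule exI[of _ g'])
        (auto simp: g'_def intro!: g'[unfolded g'_def] continuous_intros v'_cont)
  qed
  then show ?thesis by blast
qed

theorem theorem3p3:
  fixes T :: real
    and X X0 Xu :: "(real^'n) set"
    and f :: "real \<Rightarrow> real^'n \<Rightarrow> real^'n"
    and c :: "real^'n \<Rightarrow> real^'n \<Rightarrow> real"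
  assumes "0 \<le> T"
    and "X0 \<subseteq> X" and "X0 \<noteq> {}"
    and "Xu \<subseteq> X" and "Xu \<noteq> {}"
    and f_loc_lipschitz: "locally_lipschitz_on ({0..T} \<times> UNIV) (\<lambda>(t, x). f t x)"
    and A1: "compact X" "compact Xu" "compact X0"
    and A2: "\<exists>L. (\<forall>x\<in>X. L-lipschitz_on {0..T} (\<lambda>t. f t x)) \<and> (\<forall>t\<in>{0..T}. L-lipschitz_on X (f t))"
    and A3: "continuous_on (X \<times> Xu) (\<lambda>(x, y). c x y)"
    and A4: "\<And>x0 t. x0 \<in> X0 \<Longrightarrow> t \<in> {0..T} \<Longrightarrow> traj_in f x0 t (frontier X)
              \<Longrightarrow> \<forall>t'\<in>{t<..T}. \<not> traj_in f x0 t' X"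
  shows "dual_value T X X0 Xu f c = closest_approach T X X0 Xu f c"
proof (rule antisym)
  show "dual_value T X X0 Xu f c \<le> closest_approach T X X0 Xu f c"
    unfolding dual_value_def closest_approach_def
    by (rule Sup_least, rule Inf_greatest) (auto dest: weak_duality[OF f_loc_lipschitz])
  show "closest_approach T X X0 Xu f c \<le> dual_value T X X0 Xu f c"
  proof (rule dense_le)
    fix a assume a: "a < closest_approach T X X0 Xu f c"
    show "a \<le> dual_value T X X0 Xu f c"
    proof (cases a)
      case (real b)
      \<comment> \<open>A real \<open>q\<close> strictly between \<open>a\<close> and the infimum is
        a lower bound for all costs and leaves the positive gap \<open>q - b\<close> for the
        approximation.\<close>
      obtain q where q: "a < ereal q" "ereal q < closest_approach T X X0 Xu f c"
        using ereal_dense2[OF a] by blast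
      have "q \<le> c (traj f x0 t) y" if "(t, x0) \<in> admissible T X X0 f" "y \<in> Xu" for t x0 y
      proof -
        have "closest_approach T X X0 Xu f c \<le> ereal (c (traj f x0 t) y)"
          unfolding closest_approach_def by (rule Inf_lower) (use that in blast)
        with q(2) show ?thesis by (metis ereal_less_eq(3) less_imp_le order_trans)
      qed
      from near_optimal_dual[OF assms(1) A1(1,2) assms(5) A1(3) assms(2,3) f_loc_lipschitz A3 this, of "q - b"]
      obtain v w where "dual_feasible T X X0 Xu f c b v w" using q(1) real by auto
      then have "ereal b \<le> dual_value T X X0 Xu f c"
        unfolding dual_value_def by (intro Sup_upper) blast
      then show ?thesis by (simp add: real)
    qed (use a in auto)
  qed
qed

end
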